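(* Let $\mathcal{X}\subseteq\mathbb{R}^n$ be a polytope (with diameter $D>0$), let $f$ be an $(M,\nu)$ generalized self-concordant function with $\nu\ge2$ whose domain $\mathrm{dom}(f)$ does not contain any straight line, and let $\mathbf{x}_0\in\mathrm{dom}(f)$ be a vertex of $\mathcal{X}$. Let $\mathcal{L}_0=\{\mathbf{x}\in\mathrm{dom}(f)\cap\mathcal{X}: f(\mathbf{x})\le f(\mathbf{x}_0)\}$. Then the iterates of both the Away-step Frank-Wolfe algorithm with backtracking (B-AFW) and the Blended Pairwise Conditional Gradients algorithm with backtracking (B-BPCG), started at $\mathbf{x}_0$, satisfy for all $t\ge 1$ $$h(\mathbf{x}_t)\le h(\mathbf{x}_0)\left(1-\frac{\mu_f^{\mathcal{L}_0}}{4\tilde L}\left(\frac{\delta}{D}\right)^2\right)^{\lceil(t-1)/2\rceil},$$ where $\delta$ is the pyramidal width of $\mathcal{X}$, $\tilde L=\max\{\tau L_f^{\mathcal{L}_0},L_{-1}\}$, $\tau>1$ is the backtracking parameter, and $L_{-1}$ is the initial smoothness estimate.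
   Context: Generalized self-concordance: let $f:\mathbb{R}^n\to\mathbb{R}\cup\{+\infty\}$ be a closed convex function whose domain $\mathrm{dom}(f)=\{\mathbf{x}: f(\mathbf{x})<+\infty\}$ is open, with $f\in C^3(\mathrm{dom}(f))$. For $M\ge 0$, $f$ is $(M,\nu)$ generalized self-concordant if for all $\mathbf{x}\in\mathrm{dom}(f)$ and $\mathbf{u},\mathbf{w}\in\mathbb{R}^n$ (with $\mathbf{w}\ne 0$ if $\nu>3$) $$|\langle D^3f(\mathbf{x})[\mathbf{w}]\mathbf{u},\mathbf{u}\rangle|\le M\,\|\mathbf{u}\|_{\nabla^2f(\mathbf{x})}^2\,\|\mathbf{w}\|_{\nabla^2f(\mathbf{x})}^{\nu-2}\,\|\mathbf{w}\|_2^{3-\nu},$$ where $D^3f(\mathbf{x})[\mathbf{w}]=\lim_{\alpha\to0}\alpha^{-1}(\nabla^2f(\mathbf{x}+\alpha\mathbf{w})-\nabla^2f(\mathbf{x}))$, $\|\mathbf{u}\|_H^2=\langle H\mathbf{u},\mathbf{u}\rangle$, and $0^0=1$. Notation: $\|\cdot\|$ is the Euclidean norm; $D=\max_{\mathbf{x},\mathbf{y}\in\mathcal{X}}\|\mathbf{x}-\mathbf{y}\|$; $\mathbf{x}^*$ is a minimizer of $f$ over $\mathcal{X}$; $h(\mathbf{x})=f(\mathbf{x})-f(\mathbf{x}^* )$. For a compact convex $\mathcal{C}\subseteq\mathrm{dom}(f)$, $L_f^{\mathcal{C}}$ and $\mu_f^{\mathcal{C}}$ are the maximum and the minimum, respectively,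 of $\|\mathbf{d}\|^2_{\nabla^2f(\mathbf{u})}/\|\mathbf{d}\|^2$ over $\mathbf{u}\in\mathcal{C}$, $\mathbf{d}\in\mathbb{R}^n\setminus\{0\}$. Pyramidal width (Lacoste-Julien and Jaggi): let $A$ be the vertex set of $\mathcal{X}$. For a finite set $B\subseteq\mathbb{R}^n$ and $\mathbf{x}\in\mathrm{conv}(B)$ let $\mathcal{S}_{\mathbf{x}}(B)$ be the family of subsets $S\subseteq B$ such that $\mathbf{x}$ is a convex combination of all elements of $S$ with strictly positive weights; for $\mathbf{r}\neq0$ set $\mathrm{PdirW}(B,\mathbf{r},\mathbf{x})=\min_{S\in\mathcal{S}_{\mathbf{x}}(B)}\max_{\mathbf{s}\in B,\,\mathbf{u}\in S}\langle\mathbf{r}/\|\mathbf{r}\|,\mathbf{s}-\mathbf{u}\rangle$. The pyramidal width is $\delta=\min\mathrm{PdirW}(K\cap A,\mathbf{r},\mathbf{x})$ over all faces $K$ of $\mathcal{X}$, points $\mathbf{x}\in K$ and $\mathbf{r}\in\mathrm{cone}(K-\mathbf{x})\setminus\{0\}$. Procedure Backtrack$(f,\mathbf{x},\mathbf{d},L,\gamma_{\max})$ with fixed parameters $\tau>1$ and $0<\eta\le1$: choose a starting value $K\in[\eta L,L]$ and set $\gamma=\min\{-\langle\nabla f(\mathbf{x}),\mathbf{d}\rangle/(K\|\mathbf{d}\|^2),\gamma_{\max}\}$ (with $\gamma=0$ if $\mathbf{d}=0$). While $\mathbf{x}+\gamma\mathbf{d}\notin\mathrm{dom}(f)$ or $f(\mathbf{x}+\gamma\mathbf{d})-f(\mathbf{x})>\frac{K\gamma^2}{2}\|\mathbf{d}\|^2+\gamma\langle\nabla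 f(\mathbf{x}),\mathbf{d}\rangle$, replace $K$ by $\tau K$ and recompute $\gamma$ by the same formula. Return the final pair $(\gamma,K)$. Both algorithms take a vertex $\mathbf{x}_0\in\mathrm{dom}(f)$ of $\mathcal{X}$ and $L_{-1}>0$, and maintain an active set $\mathcal{S}_t$ of vertices and strictly positive weights $\boldsymbol\lambda_t$ summing to one with $\mathbf{x}_t=\sum_{\mathbf{u}\in\mathcal{S}_t}\boldsymbol\lambda_t(\mathbf{u})\mathbf{u}$; initially $\mathcal{S}_0=\{\mathbf{x}_0\}$, $\boldsymbol\lambda_0(\mathbf{x}_0)=1$. At iteration $t$, choose a vertex $\mathbf{v}_t\in\arg\min_{\mathbf{v}\in\mathcal{X}}\langle\nabla f(\mathbf{x}_t),\mathbf{v}\rangle$, $\mathbf{a}_t\in\arg\max_{\mathbf{v}\in\mathcal{S}_t}\langle\nabla f(\mathbf{x}_t),\mathbf{v}\rangle$ and (for B-BPCG) $\mathbf{s}_t\in\arg\min_{\mathbf{v}\in\mathcal{S}_t}\langle\nabla f(\mathbf{x}_t),\mathbf{v}\rangle$. - B-AFW: if $\langle\nabla f(\mathbf{x}_t),\mathbf{x}_t-\mathbf{v}_t\rangle\ge\langle\nabla f(\mathbf{x}_t),\mathbf{a}_t-\mathbf{x}_t\rangle$ (Frank-Wolfe step), $\mathbf{d}_t=\mathbf{v}_t-\mathbf{x}_t$ and $\gamma_{\max}=1$; otherwise (away step) $\mathbf{d}_t=\mathbf{x}_t-\mathbf{a}_t$ and $\gamma_{\max}=\boldsymbol\lambda_t(\mathbf{a}_t)/(1-\boldsymbol\lambda_t(\mathbf{a}_t))$.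 - B-BPCG: if $\langle\nabla f(\mathbf{x}_t),\mathbf{x}_t-\mathbf{v}_t\rangle\ge\langle\nabla f(\mathbf{x}_t),\mathbf{a}_t-\mathbf{s}_t\rangle$ (Frank-Wolfe step), $\mathbf{d}_t=\mathbf{v}_t-\mathbf{x}_t$ and $\gamma_{\max}=1$; otherwise (pairwise step) $\mathbf{d}_t=\mathbf{s}_t-\mathbf{a}_t$ and $\gamma_{\max}=\boldsymbol\lambda_t(\mathbf{a}_t)$. In both, $(\gamma_t,L_t)$ is the output of Backtrack$(f,\mathbf{x}_t,\mathbf{d}_t,L_{t-1},\gamma_{\max})$ and $\mathbf{x}_{t+1}=\mathbf{x}_t+\gamma_t\mathbf{d}_t$. Weights are updated accordingly: in a Frank-Wolfe step all weights are multiplied by $1-\gamma_t$ and $\gamma_t$ is added to the weight of $\mathbf{v}_t$; in an away step all weights are multiplied by $1+\gamma_t$ and $\gamma_t$ is subtracted from the weight of $\mathbf{a}_t$; in a pairwise step $\gamma_t$ is moved from the weight of $\mathbf{a}_t$ to that of $\mathbf{s}_t$. $\mathcal{S}_{t+1}$ is the set of vertices with positive weight. *)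

theory Defs
  imports "HOL-Analysis.Analysis"
begin

subsection \<open>Extended-valued closed convex functions\<close>

definition edom :: "('a \<Rightarrow> ereal) \<Rightarrow> 'a set" where
  "edom f = {x. f x < \<infinity>}"

text \<open>The real-valued part of \<open>f\<close>; it is meaningful only on \<^term>\<open>edom f\<close>, and is only
  evaluated or differentiated there.\<close>
definition rpart :: "('a \<Rightarrow> ereal) \<Rightarrow> 'a \<Rightarrow> real" where
  "rpart f x = real_of_ereal (f x)"

definition ext_epigraph :: "('a \<Rightarrow> ereal) \<Rightarrow> ('a \<times> real) set" where
  "ext_epigraph f = {(x, r). f x \<le> ereal r}"

definition closed_convex_fun :: "('a::real_normed_vector \<Rightarrow> ereal) \<Rightarrow> bool" where
  "closed_convex_fun f \<longleftrightarrow>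
     (\<forall>x. f x \<noteq> -\<infinity>) \<and> convex (ext_epigraph f) \<and> closed (ext_epigraph f)"

definition contains_line :: "'a::real_vector set \<Rightarrow> bool" where
  "contains_line S \<longleftrightarrow> (\<exists>x d. d \<noteq> 0 \<and> (\<forall>s. x + s *\<^sub>R d \<in> S))"


subsection \<open>Derivatives\<close>

text \<open>\<open>k\<close>-fold continuous differentiability on an open subset of a finite-dimensional space,
  expressed through iterated directional derivatives.\<close>
primrec Ck_on :: "nat \<Rightarrow> ('a::euclidean_space \<Rightarrow> real) \<Rightarrow> 'a set \<Rightarrow> bool" where
  "Ck_on 0 g S \<longleftrightarrow> continuous_on S g"
| "Ck_on (Suc k) g S \<longleftrightarrow>
     (\<forall>x\<in>S. g differentiable (at x)) \<and>
     (\<forall>h. Ck_on k (\<lambda>x. frechet_derivative g (at x) h) S)"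

definition grad :: "(real^'n \<Rightarrow> ereal) \<Rightarrow> real^'n \<Rightarrow> real^'n" where
  "grad f x = (THE g. GDERIV (rpart f) x :> g)"

definition hess :: "(real^'n \<Rightarrow> ereal) \<Rightarrow> real^'n \<Rightarrow> real^'n^'n" where
  "hess f x = jacobian (grad f) (at x)"

definition D3 :: "(real^'n \<Rightarrow> ereal) \<Rightarrow> real^'n \<Rightarrow> real^'n \<Rightarrow> real^'n^'n" where
  "D3 f x w = Lim (at 0) (\<lambda>\<alpha>. inverse \<alpha> *\<^sub>R (hess f (x + \<alpha> *\<^sub>R w) - hess f x))"

definition mat_norm_sq :: "real^'n^'n \<Rightarrow> real^'n \<Rightarrow> real" where
  "mat_norm_sq H u = (H *v u) \<bullet> u"

definition mat_norm :: "real^'n^'n \<Rightarrow> real^'n \<Rightarrow> real" where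
  "mat_norm H u = sqrt (mat_norm_sq H u)"

text \<open>Real powers of nonnegative reals with \<open>0\<^sup>0 = 1\<close>, whereas the library has
  \<^term>\<open>0 powr 0 = (0::real)\<close>.\<close>
definition rpow :: "real \<Rightarrow> real \<Rightarrow> real" where
  "rpow a b = (if b = 0 then 1 else a powr b)"

text \<open>The inequality is meant for \<open>\<nu> \<ge> 2\<close>. For \<open>\<nu> < 2\<close> the factor with exponent \<open>\<nu> - 2\<close>
  would be a negative power of a possibly vanishing quantity, which \<^const>\<open>powr\<close> sets to
  \<open>0\<close> and not to \<open>\<infinity>\<close>.\<close>
definition gen_self_concordant :: "real \<Rightarrow> real \<Rightarrow> (real^'n \<Rightarrow> ereal) \<Rightarrow> bool" where
  "gen_self_concordant M \<nu> f \<longleftrightarrow>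
     closed_convex_fun f \<and> open (edom f) \<and> Ck_on 3 (rpart f) (edom f) \<and> M \<ge> 0 \<and>
     (\<forall>x\<in>edom f. \<forall>u w. (\<nu> > 3 \<longrightarrow> w \<noteq> 0) \<longrightarrow>
        \<bar>(D3 f x w *v u) \<bullet> u\<bar>
          \<le> M * mat_norm_sq (hess f x) u * rpow (mat_norm (hess f x) w) (\<nu> - 2)
              * rpow (norm w) (3 - \<nu>))"

text \<open>For nonempty compact \<open>C \<subseteq> dom f\<close> and twice continuously differentiable \<open>f\<close> the
  quotients attain their supremum and infimum.\<close>
definition hess_quotients :: "(real^'n \<Rightarrow> ereal) \<Rightarrow> (real^'n) set \<Rightarrow> real set" where
  "hess_quotients f C = {mat_norm_sq (hess f u) d / (norm d)\<^sup>2 | u d. u \<in> C \<and> d \<noteq> 0}"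

definition smoothness_const :: "(real^'n \<Rightarrow> ereal) \<Rightarrow> (real^'n) set \<Rightarrow> real" where
  "smoothness_const f C = Sup (hess_quotients f C)"

definition strong_convexity_const :: "(real^'n \<Rightarrow> ereal) \<Rightarrow> (real^'n) set \<Rightarrow> real" where
  "strong_convexity_const f C = Inf (hess_quotients f C)"


subsection \<open>Pyramidal width\<close>

definition vertices :: "'a::real_vector set \<Rightarrow> 'a set" where
  "vertices X = {v. v extreme_point_of X}"

definition proper_supports :: "'a::real_vector \<Rightarrow> 'a set \<Rightarrow> 'a set set" where
  "proper_supports x B =
     {S. S \<subseteq> B \<and> (\<exists>c. (\<forall>s\<in>S. c s > 0) \<and> sum c S = (1::real) \<and> (\<Sum>s\<in>S. c s *\<^sub>R s) = x)}"

text \<open>Used for finite \<open>B\<close> and \<open>x \<in> convex hull B\<close>, so that \<^const>\<open>Min\<close> and \<^const>\<open>Max\<close>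
  range over finite nonempty sets.\<close>
definition pyr_dir_width :: "'a::real_inner set \<Rightarrow> 'a \<Rightarrow> 'a \<Rightarrow> real" where
  "pyr_dir_width B r x =
     Min ((\<lambda>S. Max ((\<lambda>(s, u). (r /\<^sub>R norm r) \<bullet> (s - u)) ` (B \<times> S))) ` proper_supports x B)"

text \<open>For a polytope \<open>X\<close> with more than one point the infimum is attained: for a fixed face \<open>K\<close>
  the points \<open>x\<close> give rise to finitely many pairs of a family of supports and a (closed) cone,
  and the width depends continuously on the direction \<open>r\<close>, which may be normalised.\<close>
definition pyramidal_width :: "'a::real_inner set \<Rightarrow> real" where
  "pyramidal_width X =
     Inf {pyr_dir_width (K \<inter> vertices X) r x | K r x.
            K face_of X \<and> x \<in> K \<and> r \<in> cone hull ((\<lambda>y. y - x) ` K) \<and> r \<noteq> 0}"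


subsection \<open>Backtracking\<close>

definition bt_gamma ::
  "(real^'n \<Rightarrow> ereal) \<Rightarrow> real^'n \<Rightarrow> real^'n \<Rightarrow> real \<Rightarrow> real \<Rightarrow> real" where
  "bt_gamma f x d \<gamma>max K =
     (if d = 0 then 0 else min (- (grad f x \<bullet> d) / (K * (norm d)\<^sup>2)) \<gamma>max)"

definition bt_reject ::
  "(real^'n \<Rightarrow> ereal) \<Rightarrow> real^'n \<Rightarrow> real^'n \<Rightarrow> real \<Rightarrow> real \<Rightarrow> bool" where
  "bt_reject f x d \<gamma>max K \<longleftrightarrow>
     (let \<gamma> = bt_gamma f x d \<gamma>max K in
        x + \<gamma> *\<^sub>R d \<notin> edom f \<or>
        f (x + \<gamma> *\<^sub>R d) - f x > ereal (K * \<gamma>\<^sup>2 / 2 * (norm d)\<^sup>2 + \<gamma> * (grad f x \<bullet> d)))"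

text \<open>\<open>bt_loop f \<tau> x d \<gamma>max K \<gamma> K'\<close>: the while loop, entered with the value \<open>K\<close>, terminates with
  the pair \<open>(\<gamma>, K')\<close>.\<close>
inductive bt_loop ::
  "(real^'n \<Rightarrow> ereal) \<Rightarrow> real \<Rightarrow> real^'n \<Rightarrow> real^'n \<Rightarrow> real \<Rightarrow> real \<Rightarrow> real \<Rightarrow> real \<Rightarrow> bool"
  for f \<tau> x d \<gamma>max where
  stop: "\<not> bt_reject f x d \<gamma>max K \<Longrightarrow> bt_loop f \<tau> x d \<gamma>max K (bt_gamma f x d \<gamma>max K) K"
| continue: "bt_reject f x d \<gamma>max K \<Longrightarrow> bt_loop f \<tau> x d \<gamma>max (\<tau> * K) \<gamma> K'
    \<Longrightarrow> bt_loop f \<tau> x d \<gamma>max K \<gamma> K'"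

text \<open>A relation and not a function, since the starting value is an arbitrary choice.\<close>
definition backtrack ::
  "(real^'n \<Rightarrow> ereal) \<Rightarrow> real \<Rightarrow> real \<Rightarrow> real^'n \<Rightarrow> real^'n \<Rightarrow> real \<Rightarrow> real \<Rightarrow> real \<Rightarrow> real \<Rightarrow> bool"
  where
  "backtrack f \<tau> \<eta> x d L \<gamma>max \<gamma> K' \<longleftrightarrow> (\<exists>K\<in>{\<eta> * L..L}. bt_loop f \<tau> x d \<gamma>max K \<gamma> K')"


subsection \<open>The two algorithms\<close>

text \<open>At iteration \<open>t\<close> the last field holds the previous estimate \<open>L\<^bsub>t-1\<^esub>\<close>. Weights are total
  functions vanishing off the active set.\<close>
record 'a fw_state =
  iterate :: 'a
  active :: "'a set"
  weight :: "'a \<Rightarrow> real"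
  estimate :: real

definition fw_init :: "'a \<Rightarrow> real \<Rightarrow> 'a fw_state" where
  "fw_init x0 L = \<lparr>iterate = x0, active = {x0}, weight = (\<lambda>u. if u = x0 then 1 else 0),
                    estimate = L\<rparr>"

definition fw_next :: "'a::real_vector set \<Rightarrow> 'a \<Rightarrow> ('a \<Rightarrow> real) \<Rightarrow> real \<Rightarrow> 'a fw_state" where
  "fw_next X x w L =
     \<lparr>iterate = x, active = {u \<in> vertices X. w u > 0}, weight = w, estimate = L\<rparr>"

definition fw_weights :: "real \<Rightarrow> 'a \<Rightarrow> ('a \<Rightarrow> real) \<Rightarrow> 'a \<Rightarrow> real" where
  "fw_weights \<gamma> v w = (\<lambda>u. (1 - \<gamma>) * w u + (if u = v then \<gamma> else 0))"

definition away_weights :: "real \<Rightarrow> 'a \<Rightarrow> ('a \<Rightarrow> real) \<Rightarrow> 'a \<Rightarrow> real" where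
  "away_weights \<gamma> a w = (\<lambda>u. (1 + \<gamma>) * w u - (if u = a then \<gamma> else 0))"

definition pairwise_weights :: "real \<Rightarrow> 'a \<Rightarrow> 'a \<Rightarrow> ('a \<Rightarrow> real) \<Rightarrow> 'a \<Rightarrow> real" where
  "pairwise_weights \<gamma> a s w =
     (\<lambda>u. w u - (if u = a then \<gamma> else 0) + (if u = s then \<gamma> else 0))"

text \<open>One iteration, as a relation: all admissible choices of \<open>v\<close>, \<open>a\<close>, \<open>s\<close> and of the
  starting value in the backtracking are allowed.\<close>
definition bafw_step ::
  "(real^'n \<Rightarrow> ereal) \<Rightarrow> (real^'n) set \<Rightarrow> real \<Rightarrow> real \<Rightarrow>
   (real^'n) fw_state \<Rightarrow> (real^'n) fw_state \<Rightarrow> bool" where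
  "bafw_step f X \<tau> \<eta> \<sigma> \<sigma>' \<longleftrightarrow>
     (let x = iterate \<sigma>; w = weight \<sigma>; g = grad f x in
      \<exists>v a \<gamma> L.
        v \<in> vertices X \<and> is_arg_min (\<lambda>y. g \<bullet> y) (\<lambda>y. y \<in> X) v \<and>
        is_arg_max (\<lambda>y. g \<bullet> y) (\<lambda>y. y \<in> active \<sigma>) a \<and>
        (if g \<bullet> (x - v) \<ge> g \<bullet> (a - x) then
           backtrack f \<tau> \<eta> x (v - x) (estimate \<sigma>) 1 \<gamma> L \<and>
           \<sigma>' = fw_next X (x + \<gamma> *\<^sub>R (v - x)) (fw_weights \<gamma> v w) L
         else
           backtrack f \<tau> \<eta> x (x - a) (estimate \<sigma>) (w a / (1 - w a)) \<gamma> L \<and>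
           \<sigma>' = fw_next X (x + \<gamma> *\<^sub>R (x - a)) (away_weights \<gamma> a w) L))"

definition bbpcg_step ::
  "(real^'n \<Rightarrow> ereal) \<Rightarrow> (real^'n) set \<Rightarrow> real \<Rightarrow> real \<Rightarrow>
   (real^'n) fw_state \<Rightarrow> (real^'n) fw_state \<Rightarrow> bool" where
  "bbpcg_step f X \<tau> \<eta> \<sigma> \<sigma>' \<longleftrightarrow>
     (let x = iterate \<sigma>; w = weight \<sigma>; g = grad f x in
      \<exists>v a s \<gamma> L.
        v \<in> vertices X \<and> is_arg_min (\<lambda>y. g \<bullet> y) (\<lambda>y. y \<in> X) v \<and>
        is_arg_max (\<lambda>y. g \<bullet> y) (\<lambda>y. y \<in> active \<sigma>) a \<and>
        is_arg_min (\<lambda>y. g \<bullet> y) (\<lambda>y. y \<in> active \<sigma>) s \<and>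
        (if g \<bullet> (x - v) \<ge> g \<bullet> (a - s) then
           backtrack f \<tau> \<eta> x (v - x) (estimate \<sigma>) 1 \<gamma> L \<and>
           \<sigma>' = fw_next X (x + \<gamma> *\<^sub>R (v - x)) (fw_weights \<gamma> v w) L
         else
           backtrack f \<tau> \<eta> x (s - a) (estimate \<sigma>) (w a) \<gamma> L \<and>
           \<sigma>' = fw_next X (x + \<gamma> *\<^sub>R (s - a)) (pairwise_weights \<gamma> a s w) L))"

text \<open>A state that a run of B-AFW (B-BPCG) can be in after \<open>t\<close> iterations, with any choices made
  on the way; \<open>L\<close> is the initial smoothness estimate.\<close>
definition bafw_reach ::
  "(real^'n \<Rightarrow> ereal) \<Rightarrow> (real^'n) set \<Rightarrow> real \<Rightarrow> real \<Rightarrow> real \<Rightarrow> real^'n \<Rightarrow> nat \<Rightarrow>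
   (real^'n) fw_state \<Rightarrow> bool" where
  "bafw_reach f X \<tau> \<eta> L x0 t \<sigma> \<longleftrightarrow> (bafw_step f X \<tau> \<eta> ^^ t) (fw_init x0 L) \<sigma>"

definition bbpcg_reach ::
  "(real^'n \<Rightarrow> ereal) \<Rightarrow> (real^'n) set \<Rightarrow> real \<Rightarrow> real \<Rightarrow> real \<Rightarrow> real^'n \<Rightarrow> nat \<Rightarrow>
   (real^'n) fw_state \<Rightarrow> bool" where
  "bbpcg_reach f X \<tau> \<eta> L x0 t \<sigma> \<longleftrightarrow> (bbpcg_step f X \<tau> \<eta> ^^ t) (fw_init x0 L) \<sigma>"

end

theory Submission
  imports Defs
begin

text \<open>On the compact convex level set \<open>L0\<close> the Hessian lies between the strong convexity and the
  smoothness constant. Since the iterates never leave \<open>L0\<close>, the backtracking estimate never exceeds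
  \<open>Lt\<close>, and a step along \<open>d\<close> that is not cut off at its maximal length decreases \<open>f\<close> by
  at least \<open>(\<nabla>f(x) \<bullet> d)\<^sup>2 / (2 Lt D\<^sup>2)\<close>. The chosen direction carries at least half of
  \<open>\<nabla>f(x) \<bullet> (a - v)\<close>, which the pyramidal width and strong convexity bound from below in
  terms of the primal gap; so such a step contracts the gap. A Frank-Wolfe step that is cut off at
  length one halves the gap by convexity. A cut-off away or pairwise step removes a vertex from the
  active set, and only Frank-Wolfe steps add one, so at most half of the steps are of this kind.\<close>

subsection \<open>Pyramidal width\<close>

text \<open>The obstacle is that \<open>f\<close> may be infinite on parts of \<open>X\<close>, so a
  smoothness constant need not exist on \<open>X\<close> or along a full step. All second-order
  estimates are therefore confined to \<open>L0\<close>, and a trial point must be shown to lie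
  there before the quadratic bound that accepts it may be used. The constant 4 in the rate arises as
  \<open>4 * 2 / 2\<close>: squaring the factor one half of the chosen slope gives 4, the decrease
  of an uncut step gives \<open>2 * Lt\<close>, and strong convexity gives \<open>2 * mu\<close>.
  Since the pyramidal width is at most the diameter and \<open>mu \<le> Lt\<close>, the rate is at
  least 3/4 when \<open>mu\<close> is nonnegative, so a step that halves the gap also meets it. The
  estimates of a single step assume \<open>0 \<le> mu\<close>. For negative \<open>mu\<close> the
  rate is at least one, and monotonicity of \<open>f\<close> along the run is enough.\<close>

lemma finite_vertices: "polytope (X::'a::euclidean_space set) \<Longrightarrow> finite (vertices X)"
  unfolding vertices_def by (simp add: finite_polyhedron_extreme_points polytope_imp_polyhedron)

lemma vertices_subset: "vertices X \<subseteq> X"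
  by (auto simp: vertices_def extreme_point_of_def)

lemma finite_proper_supports: "finite B \<Longrightarrow> finite (proper_supports x B)"
  by (rule finite_subset[of _ "Pow B"]) (auto simp: proper_supports_def)

text \<open>Keeps the \<open>Min\<close> in \<open>pyr_dir_width\<close> from ranging over the empty
  family. A face is the hull of the vertices of \<open>X\<close> in it, and discarding zero
  coefficients leaves strictly positive ones.\<close>

lemma proper_supports_nonempty:
  fixes X :: "'a::euclidean_space set"
  assumes X: "polytope X" and K: "K face_of X" and x: "x \<in> K"
  shows "proper_supports x (K \<inter> vertices X) \<noteq> {}"
proof -
  let ?V = "K \<inter> vertices X"
  have "K = convex hull {v. v extreme_point_of K}"
    using face_of_polytope_polytope[OF X K]
    by (simp add: Krein_Milman_Minkowski polytope_imp_compact polytope_imp_convex)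
  moreover have "{v. v extreme_point_of K} = ?V"
    using extreme_point_of_face[OF K] by (auto simp: vertices_def)
  ultimately have xh: "x \<in> convex hull ?V" using x by simp
  have fin: "finite ?V" using finite_vertices[OF X] by blast
  from xh obtain c where c: "\<forall>v\<in>?V. 0 \<le> c v" "sum c ?V = 1" "(\<Sum>v\<in>?V. c v *\<^sub>R v) = x"
    unfolding convex_hull_finite[OF fin] by blast
  define S where "S = {v\<in>?V. c v > 0}"
  have SV: "S \<subseteq> ?V" and z: "\<forall>v\<in>?V - S. c v = 0"
    using c(1) by (auto simp: S_def order.order_iff_strict)
  have "sum c S = 1"
    using sum.mono_neutral_left[OF fin SV z] c(2) by simp
  moreover have "(\<Sum>v\<in>S. c v *\<^sub>R v) = x"
    using sum.mono_neutral_left[OF fin SV, of "\<lambda>v. c v *\<^sub>R v"] z c(3) by simp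
  ultimately have "S \<in> proper_supports x ?V"
    unfolding proper_supports_def using SV by (auto simp: S_def)
  thus ?thesis by blast
qed

text \<open>Both extrema range over finite nonempty sets and are attained. The sign comes from the
  diagonal pairs \<open>(u, u)\<close>, which compete in the maximum because a support consists of
  vertices of the face.\<close>

lemma pyr_dir_width_witness:
  fixes X :: "'a::euclidean_space set"
  assumes X: "polytope X" and K: "K face_of X" and x: "x \<in> K"
  obtains s u where "s \<in> K \<inter> vertices X" "u \<in> K \<inter> vertices X"
    "pyr_dir_width (K \<inter> vertices X) r x = (r /\<^sub>R norm r) \<bullet> (s - u)" "0 \<le> (r /\<^sub>R norm r) \<bullet> (s - u)"
proof -
  let ?V = "K \<inter> vertices X"
  let ?g = "\<lambda>(s, u). (r /\<^sub>R norm r) \<bullet> (s - u)"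
  have fin: "finite ?V" using finite_vertices[OF X] by blast
  have "pyr_dir_width ?V r x \<in> (\<lambda>S. Max (?g ` (?V \<times> S))) ` proper_supports x ?V"
    unfolding pyr_dir_width_def using proper_supports_nonempty[OF X K x] finite_proper_supports[OF fin]
    by (intro Min_in) auto
  then obtain S where S: "S \<in> proper_supports x ?V"
    and eq: "pyr_dir_width ?V r x = Max (?g ` (?V \<times> S))" by blast
  have SV: "S \<subseteq> ?V" and "S \<noteq> {}" using S by (auto simp: proper_supports_def)
  then obtain u0 where u0: "u0 \<in> S" by blast
  have finP: "finite (?g ` (?V \<times> S))" using fin SV by (meson finite_SigmaI finite_imageI finite_subset)
  have "?g (u0, u0) \<in> ?g ` (?V \<times> S)" using u0 SV by blast
  hence "0 \<le> Max (?g ` (?V \<times> S))" "Max (?g ` (?V \<times> S)) \<in> ?g ` (?V \<times> S)"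
    using Max_ge[OF finP] Max_in[OF finP] by fastforce+
  thus thesis using that eq SV by auto
qed

lemma bdd_below_pyr_dir_widths:
  fixes X :: "'a::euclidean_space set"
  assumes X: "polytope X"
  shows "bdd_below {pyr_dir_width (K \<inter> vertices X) r x | K r x.
            K face_of X \<and> x \<in> K \<and> r \<in> cone hull ((\<lambda>y. y - x) ` K) \<and> r \<noteq> 0}"
proof (rule bdd_belowI[of _ 0])
  fix w assume "w \<in> {pyr_dir_width (K \<inter> vertices X) r x | K r x.
            K face_of X \<and> x \<in> K \<and> r \<in> cone hull ((\<lambda>y. y - x) ` K) \<and> r \<noteq> 0}"
  then obtain K r x where "K face_of X" "x \<in> K" and w: "w = pyr_dir_width (K \<inter> vertices X) r x"
    by blast
  thus "0 \<le> w" using pyr_dir_width_witness[OF X, of K x r] by metis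
qed

lemma pyramidal_width_le:
  fixes X :: "'a::euclidean_space set"
  assumes "polytope X" "K face_of X" "x \<in> K" "r \<in> cone hull ((\<lambda>y. y - x) ` K)" "r \<noteq> 0"
  shows "pyramidal_width X \<le> pyr_dir_width (K \<inter> vertices X) r x"
  unfolding pyramidal_width_def
  by (rule cInf_lower[OF _ bdd_below_pyr_dir_widths[OF assms(1)]]) (use assms in blast)

lemma pyramidal_width_nonneg_le_diameter:
  fixes X :: "'a::euclidean_space set"
  assumes X: "polytope X" and D: "diameter X > 0"
  shows "0 \<le> pyramidal_width X" "pyramidal_width X \<le> diameter X"
proof -
  have bX: "bounded X" by (simp add: X polytope_imp_bounded)
  \<comment> \<open>Two distinct points supply an admissible face, point and direction; without them
    the infimum would be taken over the empty set.\<close>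
  have "\<exists>x\<in>X. \<exists>y\<in>X. x \<noteq> y"
  proof (rule ccontr)
    assume "\<not> ?thesis"
    hence "X = {} \<or> (\<exists>x. X = {x})" by blast
    thus False using D by auto
  qed
  then obtain x y where xy: "x \<in> X" "y \<in> X" "y - x \<noteq> 0" by force
  have XX: "X face_of X" using X by (simp add: face_of_refl polytope_imp_convex)
  have r: "y - x \<in> cone hull ((\<lambda>y. y - x) ` X)" using xy by (simp add: hull_inc)
  show "0 \<le> pyramidal_width X" unfolding pyramidal_width_def
  proof (rule cInf_greatest, goal_cases)
    case 1
    then show ?case using XX xy r by blast
  next
    case (2 w)
    then obtain K r x where "K face_of X" "x \<in> K" and w: "w = pyr_dir_width (K \<inter> vertices X) r x"
      by blast
    thus "0 \<le> w" using pyr_dir_width_witness[OF X, of K x r] by metis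
  qed
  obtain s u where su: "s \<in> X \<inter> vertices X" "u \<in> X \<inter> vertices X" and
    eq: "pyr_dir_width (X \<inter> vertices X) (y - x) x = ((y - x) /\<^sub>R norm (y - x)) \<bullet> (s - u)"
    by (rule pyr_dir_width_witness[OF X XX \<open>x \<in> X\<close>])
  have "((y - x) /\<^sub>R norm (y - x)) \<bullet> (s - u) \<le> norm ((y - x) /\<^sub>R norm (y - x)) * norm (s - u)"
    by (rule norm_cauchy_schwarz)
  also have "\<dots> = norm (s - u)" using xy(3) by simp
  also have "\<dots> \<le> diameter X"
    using su diameter_bounded_bound[OF bX] by (simp add: dist_norm)
  finally show "pyramidal_width X \<le> diameter X"
    using pyramidal_width_le[OF X XX \<open>x \<in> X\<close> r xy(3)] eq by simp
qed

text \<open>Moreau decomposition. The variational inequality of the nearest point, tested at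
  \<open>2 *\<^sub>R p\<close> and at \<open>0\<close>, makes the residual orthogonal to
  \<open>p\<close>; what remains of it says that the residual lies in the polar cone.\<close>

lemma convex_cone_projection:
  fixes C :: "'a::euclidean_space set"
  assumes C: "closed C" "convex C" "conic C" "C \<noteq> {}"
  obtains p where "p \<in> C" "(r - p) \<bullet> p = 0" "\<And>e. e \<in> C \<Longrightarrow> (r - p) \<bullet> e \<le> 0"
proof
  let ?p = "closest_point C r"
  show p: "?p \<in> C" using C by (simp add: closest_point_in_set)
  have dot: "(r - ?p) \<bullet> (y - ?p) \<le> 0" if "y \<in> C" for y
    using closest_point_dot[OF C(2,1) that] by simp
  have "2 *\<^sub>R ?p \<in> C" "0 *\<^sub>R ?p \<in> C" using conicD[OF C(3) p] by (simp_all del: scaleR_zero_left)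
  from dot[OF this(1)] dot[OF this(2)] show z: "(r - ?p) \<bullet> ?p = 0"
    by (simp add: inner_diff_right)
  show "(r - ?p) \<bullet> e \<le> 0" if "e \<in> C" for e
    using dot[OF that] z by (simp add: inner_diff_right)
qed

text \<open>The numbers \<open>c s * (n \<bullet> (s - x))\<close> are nonpositive and sum to zero,
  \<open>x\<close> being the barycentre; so each vanishes, and the weights are positive.\<close>

lemma proper_support_in_exposed_face:
  fixes S :: "'a::real_inner set"
  assumes "finite S" "\<And>s. s \<in> S \<Longrightarrow> c s > 0" "sum c S = (1::real)" "(\<Sum>s\<in>S. c s *\<^sub>R s) = x"
    and "\<And>s. s \<in> S \<Longrightarrow> n \<bullet> (s - x) \<le> 0" and s: "s \<in> S"
  shows "n \<bullet> (s - x) = 0"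
proof -
  have "(\<Sum>s\<in>S. c s * - (n \<bullet> (s - x))) = - (\<Sum>s\<in>S. n \<bullet> (c s *\<^sub>R s)) + (\<Sum>s\<in>S. c s) * (n \<bullet> x)"
    by (simp add: inner_diff_right sum_distrib_right sum.distrib sum_negf algebra_simps sum_subtractf)
  also have "\<dots> = 0" unfolding inner_sum_right[symmetric] using assms by simp
  finally have "(\<Sum>s\<in>S. c s * - (n \<bullet> (s - x))) = 0" .
  moreover have "\<And>s. s \<in> S \<Longrightarrow> 0 \<le> c s * - (n \<bullet> (s - x))"
    using assms(2,5) by (simp add: less_imp_le mult_nonneg_nonpos)
  ultimately have "c s * - (n \<bullet> (s - x)) = 0"
    using sum_nonneg_eq_0_iff[OF assms(1), of "\<lambda>s. c s * - (n \<bullet> (s - x))"] s by blast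
  thus ?thesis using assms(2)[OF s] by simp
qed

text \<open>An arbitrary direction \<open>r\<close> is replaced by its projection \<open>p\<close> on the cone of feasible directions
  at \<open>x\<close>. The residual \<open>r - p\<close> exposes a face that contains \<open>x\<close>, hence also its support \<open>S\<close>; on this
  face \<open>r\<close> and \<open>p\<close> have the same inner products and \<open>p\<close> is feasible.\<close>
lemma pyramidal_width_bound:
  fixes X :: "'a::euclidean_space set"
  assumes X: "polytope X" and S: "S \<in> proper_supports x (vertices X)" and x: "x \<in> X" and y: "y \<in> X"
    and pos: "r \<bullet> (y - x) > 0"
    and v: "\<And>z. z \<in> X \<Longrightarrow> r \<bullet> z \<le> r \<bullet> v" and a: "\<And>z. z \<in> S \<Longrightarrow> r \<bullet> a \<le> r \<bullet> z"
  shows "pyramidal_width X * (r \<bullet> (y - x)) \<le> norm (y - x) * (r \<bullet> (v - a))"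
proof -
  let ?X = "(\<lambda>y. y - x) ` X"
  have pX: "polytope ?X" using X polytope_translation_eq[of "- x" X] by simp
  let ?C = "conic hull ?X"
  have "closed ?C" using closed_conic_hull_strong pX by blast
  moreover have "convex ?C" by (intro convex_conic_hull polytope_imp_convex pX)
  moreover have "?C \<noteq> {}" using x by (simp add: conic_hull_eq_empty) blast
  ultimately obtain p where p: "p \<in> ?C" "(r - p) \<bullet> p = 0" "\<And>e. e \<in> ?C \<Longrightarrow> (r - p) \<bullet> e \<le> 0"
    using convex_cone_projection conic_conic_hull by metis
  have polar: "(r - p) \<bullet> (z - x) \<le> 0" if "z \<in> X" for z
    using p(3)[of "z - x"] that by (simp add: hull_inc)
  \<comment> \<open>The residual is polar to \<open>y - x\<close>, so the projection can only
    increase the slope towards \<open>y\<close>.\<close>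
  have rp: "r \<bullet> (y - x) \<le> p \<bullet> (y - x)" using polar[OF y] by (simp add: inner_diff_left)
  hence p0: "p \<noteq> 0" using pos by auto
  define K where "K = X \<inter> {z. (r - p) \<bullet> z = (r - p) \<bullet> x}"
  have K: "K face_of X" unfolding K_def
    by (rule face_of_Int_supporting_hyperplane_le)
       (use X polar in \<open>auto simp: polytope_imp_convex inner_diff_right\<close>)
  have xK: "x \<in> K" using x by (simp add: K_def)
  have pK: "p \<in> cone hull ((\<lambda>y. y - x) ` K)"
  proof -
    \<comment> \<open>Some \<open>z\<close> in \<open>X\<close> generates the ray through
      \<open>p\<close>; orthogonality of \<open>p\<close> to the residual places this
      \<open>z\<close> on the supporting hyperplane.\<close>
    obtain c z where cz: "c \<ge> 0" "z \<in> X" "p = c *\<^sub>R (z - x)"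
      using p(1) unfolding conic_hull_explicit by auto
    have "c \<noteq> 0" using cz p0 by auto
    hence "z \<in> K" using p(2) cz unfolding cz(3) K_def by (simp add: inner_diff_right)
    thus ?thesis unfolding cz(3) by (intro mem_cone_hull) (use cz in auto)
  qed
  let ?V = "K \<inter> vertices X"
  have finV: "finite ?V" using finite_vertices[OF X] by blast
  obtain c where c: "S \<subseteq> vertices X" "\<forall>s\<in>S. c s > 0" "sum c S = (1::real)" "(\<Sum>s\<in>S. c s *\<^sub>R s) = x"
    using S unfolding proper_supports_def by auto
  have finS: "finite S" "S \<noteq> {}" using c(1,3) finite_vertices[OF X] finite_subset by auto
  have SX: "S \<subseteq> X" using c(1) vertices_subset by blast
  have "(r - p) \<bullet> (s - x) = 0" if "s \<in> S" for s
    by (rule proper_support_in_exposed_face[of S c]) (use c finS that polar SX in auto)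
  hence SV: "S \<subseteq> ?V" using c(1) SX by (auto simp: K_def inner_diff_right)
  hence SP: "S \<in> proper_supports x ?V" using c by (auto simp: proper_supports_def)
  let ?g = "\<lambda>(s, u). (p /\<^sub>R norm p) \<bullet> (s - u)"
  \<comment> \<open>The width is a minimum over all supports, so the given \<open>S\<close> bounds
    it from above.\<close>
  have "pyr_dir_width ?V p x \<le> Max (?g ` (?V \<times> S))"
    unfolding pyr_dir_width_def using SP finite_proper_supports[OF finV] by (intro Min_le) auto
  moreover have "Max (?g ` (?V \<times> S)) \<in> ?g ` (?V \<times> S)"
    by (rule Max_in) (use finV finS SV in auto)
  ultimately obtain s u where su: "s \<in> ?V" "u \<in> S" 
      and le: "pyr_dir_width ?V p x \<le> (p /\<^sub>R norm p) \<bullet> (s - u)" by auto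
  have "pyramidal_width X \<le> (p \<bullet> (s - u)) / norm p"
    using pyramidal_width_le[OF X K xK pK p0] le by (simp add: field_simps)
  also have "p \<bullet> (s - u) = r \<bullet> (s - u)"
    using su SV by (auto simp: K_def inner_diff_left inner_diff_right)
  also have "\<dots> \<le> r \<bullet> (v - a)"
    using v[of s] a[OF su(2)] su(1) by (auto simp: K_def inner_diff_right)
  finally have dp: "pyramidal_width X * norm p \<le> r \<bullet> (v - a)" 
    using p0 by (simp add: field_simps)
  have X2: "diameter X > 0"
    using pos x y diameter_bounded_bound[of X x y] X polytope_imp_bounded
    by (metis diff_self inner_zero_right less_irrefl dist_pos_lt order_less_le_trans)
  have "pyramidal_width X * (r \<bullet> (y - x)) \<le> pyramidal_width X * (norm p * norm (y - x))"
    using rp norm_cauchy_schwarz[of p "y - x"] pyramidal_width_nonneg_le_diameter(1)[OF X X2]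
    by (intro mult_left_mono) auto
  also have "\<dots> \<le> norm (y - x) * (r \<bullet> (v - a))"
    using mult_left_mono[OF dp norm_ge_zero[of "y - x"]] by (simp add: mult_ac)
  finally show ?thesis .
qed

subsection \<open>Smooth convex functions\<close>

lemma Ck_on_Suc_imp_Ck_on: "Ck_on (Suc k) g S \<Longrightarrow> Ck_on k g S"
proof (induction k arbitrary: g)
  case 0
  thus ?case by (auto intro!: continuous_at_imp_continuous_on differentiable_imp_continuous_within)
next
  case (Suc k)
  have "Ck_on k (\<lambda>x. frechet_derivative g (at x) h) S" for h
    by (rule Suc.IH) (use Suc.prems in simp)
  thus ?case using Suc.prems by simp
qed

text \<open>Separates the matrix from the direction: only finitely many entries remain, each
  continuous in the base point when \<open>H\<close> is a Hessian, so a bound on a compact set is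
  uniform in all directions.\<close>

lemma mat_norm_sq_abs_le:
  fixes H :: "real^'m^'m"
  shows "\<bar>mat_norm_sq H d\<bar> \<le> (\<Sum>i\<in>Basis. \<Sum>j\<in>Basis. \<bar>(H *v i) \<bullet> j\<bar>) * (norm d)\<^sup>2"
proof -
  have "H *v d = H *v (\<Sum>i\<in>Basis. (d \<bullet> i) *\<^sub>R i)" by (simp add: euclidean_representation)
  also have "\<dots> = (\<Sum>i\<in>Basis. (d \<bullet> i) *\<^sub>R (H *v i))"
    by (simp add: linear_sum[OF matrix_vector_mul_linear] matrix_vector_mult_scaleR)
  finally have "mat_norm_sq H d = (\<Sum>i\<in>Basis. (d \<bullet> i) * ((H *v i) \<bullet> d))"
    by (simp add: mat_norm_sq_def inner_sum_left)
  also have "\<dots> = (\<Sum>i\<in>Basis. (d \<bullet> i) * (\<Sum>j\<in>Basis. ((H *v i) \<bullet> j) * (d \<bullet> j)))"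
    by (subst euclidean_inner) simp
  also have "\<dots> = (\<Sum>i\<in>Basis. \<Sum>j\<in>Basis. (d \<bullet> i) * ((H *v i) \<bullet> j) * (d \<bullet> j))"
    by (simp add: sum_distrib_left mult.assoc)
  also have "\<bar>\<dots>\<bar> \<le> (\<Sum>i\<in>Basis. \<Sum>j\<in>Basis. \<bar>(d \<bullet> i) * ((H *v i) \<bullet> j) * (d \<bullet> j)\<bar>)"
    by (rule order_trans[OF sum_abs sum_mono[OF sum_abs]])
  also have "\<dots> \<le> (\<Sum>i\<in>Basis. \<Sum>j\<in>Basis. \<bar>(H *v i) \<bullet> j\<bar> * (norm d)\<^sup>2)"
  proof (intro sum_mono)
    fix i j :: "real^'m" assume "i \<in> Basis" "j \<in> Basis"
    hence "\<bar>d \<bullet> i\<bar> * \<bar>d \<bullet> j\<bar> \<le> norm d * norm d"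
      by (intro mult_mono) (auto simp: Basis_le_norm)
    from mult_left_mono[OF this, of "\<bar>(H *v i) \<bullet> j\<bar>"]
    show "\<bar>(d \<bullet> i) * ((H *v i) \<bullet> j) * (d \<bullet> j)\<bar> \<le> \<bar>(H *v i) \<bullet> j\<bar> * (norm d)\<^sup>2"
      by (simp add: abs_mult mult_ac power2_eq_square)
  qed
  also have "\<dots> = (\<Sum>i\<in>Basis. \<Sum>j\<in>Basis. \<bar>(H *v i) \<bullet> j\<bar>) * (norm d)\<^sup>2"
    by (simp add: sum_distrib_right)
  finally show ?thesis .
qed

locale smooth_convex =
  fixes f :: "real^'n \<Rightarrow> ereal"
  assumes closed_convex: "closed_convex_fun f"
    and open_dom: "open (edom f)"
    and C2: "Ck_on 2 (rpart f) (edom f)"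
begin

lemma ereal_rpart: "x \<in> edom f \<Longrightarrow> f x = ereal (rpart f x)"
  using closed_convex unfolding closed_convex_fun_def edom_def rpart_def
  by (auto simp: ereal_real)

lemma le_ereal_imp_edom: "f x \<le> ereal r \<Longrightarrow> x \<in> edom f"
  by (auto simp: edom_def)

lemma convex_sublevel: "convex {x. f x \<le> ereal c}"
proof (rule convexI)
  fix x y u v assume *: "x \<in> {x. f x \<le> ereal c}" "y \<in> {x. f x \<le> ereal c}" "0 \<le> u" "0 \<le> v" "u + v = (1::real)"
  have "convex (ext_epigraph f)" using closed_convex by (simp add: closed_convex_fun_def)
  from convexD[OF this, of "(x, c)" "(y, c)" u v] *
  show "u *\<^sub>R x + v *\<^sub>R y \<in> {x. f x \<le> ereal c}"
    by (simp add: ext_epigraph_def distrib_right[symmetric])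
qed

text \<open>A slice of the closed epigraph, hence closed in the whole space although the domain is
  open. This makes \<open>L0\<close> a compact subset of the domain.\<close>

lemma closed_sublevel: "closed {x. f x \<le> ereal c}"
proof -
  have "closed ((\<lambda>x. (x, c)) -` ext_epigraph f)"
    by (rule closed_vimage) (use closed_convex in \<open>auto simp: closed_convex_fun_def intro!: continuous_intros\<close>)
  thus ?thesis by (simp add: ext_epigraph_def vimage_def)
qed

lemma convex_rpart: "convex_on (edom f) (rpart f)"
proof -
  have epi: "convex (ext_epigraph f)" using closed_convex by (simp add: closed_convex_fun_def)
  have *: "f (u *\<^sub>R x + v *\<^sub>R y) \<le> ereal (u * rpart f x + v * rpart f y)"
    if "x \<in> edom f" "y \<in> edom f" "0 \<le> u" "0 \<le> v" "u + v = 1" for x y u v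
    using convexD[OF epi, of "(x, rpart f x)" "(y, rpart f y)" u v] that
    by (simp add: ext_epigraph_def ereal_rpart)
  have "convex (edom f)" by (rule convexI) (use * le_ereal_imp_edom in blast)
  moreover have "rpart f (u *\<^sub>R x + v *\<^sub>R y) \<le> u * rpart f x + v * rpart f y"
    if "x \<in> edom f" "y \<in> edom f" "0 \<le> u" "0 \<le> v" "u + v = 1" for x y u v
    using *[OF that] ereal_rpart[OF le_ereal_imp_edom[OF *[OF that]]] by simp
  ultimately show ?thesis by (simp add: convex_on_def)
qed

section \<open>Gradient and Hessian as derivatives\<close>

lemma Ck_directional:
  "Ck_on 1 (\<lambda>x. frechet_derivative (rpart f) (at x) h) (edom f)"
  "Ck_on 0 (\<lambda>x. frechet_derivative (\<lambda>x. frechet_derivative (rpart f) (at x) h) (at x) k) (edom f)"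
  using C2 by (simp_all add: numeral_2_eq_2)

text \<open>\<open>grad\<close> is a definite description, so existence and uniqueness are both
  required; the candidate has the derivatives along the basis vectors as coordinates.\<close>

lemma GDERIV_grad:
  assumes x: "x \<in> edom f"
  shows "GDERIV (rpart f) x :> grad f x"
proof -
  have d: "(rpart f has_derivative frechet_derivative (rpart f) (at x)) (at x)"
    using C2 x by (simp add: numeral_2_eq_2 frechet_derivative_works[symmetric])
  define v where "v = (\<Sum>b\<in>Basis. frechet_derivative (rpart f) (at x) b *\<^sub>R b)"
  have lin: "linear (frechet_derivative (rpart f) (at x))" using d has_derivative_linear by blast
  have "frechet_derivative (rpart f) (at x) h = h \<bullet> v" for h
  proof -
    have "frechet_derivative (rpart f) (at x) h
        = frechet_derivative (rpart f) (at x) (\<Sum>b\<in>Basis. (h \<bullet> b) *\<^sub>R b)"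
      by (simp add: euclidean_representation)
    also have "\<dots> = h \<bullet> v"
      unfolding linear_sum[OF lin] linear_scale[OF lin] v_def inner_sum_right by (simp add: mult_ac)
    finally show ?thesis .
  qed
  hence g: "GDERIV (rpart f) x :> v" using d unfolding gderiv_def by (metis (no_types, lifting) ext)
  have "w = v" if "GDERIV (rpart f) x :> w" for w
    using has_derivative_unique[of "rpart f"] that g unfolding gderiv_def fun_eq_iff
    by (metis inner_commute vector_eq_rdot)
  with g show ?thesis unfolding grad_def by (rule theI)
qed

lemma inner_grad: "x \<in> edom f \<Longrightarrow> grad f x \<bullet> h = frechet_derivative (rpart f) (at x) h"
  using GDERIV_grad[of x] frechet_derivative_at[of "rpart f" "\<lambda>h. h \<bullet> grad f x" x]
  unfolding gderiv_def by (metis inner_commute)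

lemma has_derivative_inner_grad:
  assumes x: "x \<in> edom f"
  shows "((\<lambda>y. grad f y \<bullet> h) has_derivative
    frechet_derivative (\<lambda>y. frechet_derivative (rpart f) (at y) h) (at x)) (at x)"
proof -
  have "((\<lambda>y. frechet_derivative (rpart f) (at y) h) has_derivative
    frechet_derivative (\<lambda>y. frechet_derivative (rpart f) (at y) h) (at x)) (at x)"
    using Ck_directional(1)[of h] x by (simp add: frechet_derivative_works[symmetric])
  \<comment> \<open>The two functions agree only on the domain; its openness carries the derivative
    over.\<close>
  thus ?thesis
    by (rule has_derivative_transform_within_open[OF _ open_dom x]) (simp add: inner_grad)
qed

lemma has_derivative_grad:
  assumes x: "x \<in> edom f"
  shows "(grad f has_derivative (\<lambda>h. hess f x *v h)) (at x)"
proof -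
  have "grad f differentiable (at x)"
    unfolding differentiable_componentwise_within[of "grad f"]
    using has_derivative_inner_grad[OF x] by (auto simp: differentiable_def)
  thus ?thesis unfolding hess_def jacobian_works .
qed

lemma inner_hess:
  assumes x: "x \<in> edom f"
  shows "(hess f x *v k) \<bullet> h
    = frechet_derivative (\<lambda>y. frechet_derivative (rpart f) (at y) h) (at x) k"
proof -
  have "((\<lambda>y. grad f y \<bullet> h) has_derivative (\<lambda>k. (hess f x *v k) \<bullet> h)) (at x)"
    by (rule has_derivative_inner_left[OF has_derivative_grad[OF x]])
  from has_derivative_unique[OF this has_derivative_inner_grad[OF x]] show ?thesis by metis
qed

lemma continuous_on_hess: "continuous_on (edom f) (\<lambda>x. (hess f x *v k) \<bullet> h)"
  using Ck_directional(2)[of h k] by (simp add: inner_hess cong: continuous_on_cong)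

text \<open>Makes the real \<open>Sup\<close> and \<open>Inf\<close> in the two constants genuine
  bounds for every quotient.\<close>

lemma bdd_hess_quotients:
  assumes C: "compact C" "C \<subseteq> edom f"
  shows "bdd_above (hess_quotients f C)" "bdd_below (hess_quotients f C)"
proof -
  let ?S = "\<lambda>u. \<Sum>i\<in>Basis. \<Sum>j\<in>Basis. \<bar>(hess f u *v i) \<bullet> j\<bar>"
  have "continuous_on C ?S"
    by (intro continuous_intros continuous_on_subset[OF continuous_on_hess C(2)])
  from compact_imp_bounded[OF compact_continuous_image[OF this C(1)]]
  obtain B where B: "\<And>u. u \<in> C \<Longrightarrow> \<bar>?S u\<bar> \<le> B" by (auto simp: bounded_iff)
  have "\<bar>r\<bar> \<le> B" if "r \<in> hess_quotients f C" for r
  proof -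
    obtain u d where ud: "u \<in> C" "d \<noteq> 0" "r = mat_norm_sq (hess f u) d / (norm d)\<^sup>2"
      using \<open>r \<in> hess_quotients f C\<close> by (auto simp: hess_quotients_def)
    have "\<bar>r\<bar> \<le> ?S u"
      using mat_norm_sq_abs_le[of "hess f u" d] ud(2) by (simp add: ud(3) abs_divide divide_simps)
    thus ?thesis using B[OF ud(1)] by linarith
  qed
  hence "\<And>r. r \<in> hess_quotients f C \<Longrightarrow> r \<le> B" "\<And>r. r \<in> hess_quotients f C \<Longrightarrow> - B \<le> r"
    by (fastforce simp: abs_le_iff)+
  thus "bdd_above (hess_quotients f C)" "bdd_below (hess_quotients f C)"
    by (meson bdd_aboveI bdd_belowI)+
qed

lemma mat_norm_sq_hess_bounds:
  assumes C: "compact C" "C \<subseteq> edom f" "u \<in> C"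
  shows "strong_convexity_const f C * (norm d)\<^sup>2 \<le> mat_norm_sq (hess f u) d"
    and "mat_norm_sq (hess f u) d \<le> smoothness_const f C * (norm d)\<^sup>2"
proof -
  have "strong_convexity_const f C * (norm d)\<^sup>2 \<le> mat_norm_sq (hess f u) d
      \<and> mat_norm_sq (hess f u) d \<le> smoothness_const f C * (norm d)\<^sup>2"
  proof (cases "d = 0")
    case False
    hence "mat_norm_sq (hess f u) d / (norm d)\<^sup>2 \<in> hess_quotients f C"
      using C(3) by (auto simp: hess_quotients_def)
    from cInf_lower[OF this bdd_hess_quotients(2)[OF C(1,2)]]
      cSup_upper[OF this bdd_hess_quotients(1)[OF C(1,2)]]
    show ?thesis using False
      by (simp add: smoothness_const_def strong_convexity_const_def divide_simps)
  qed (simp add: mat_norm_sq_def)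
  thus "strong_convexity_const f C * (norm d)\<^sup>2 \<le> mat_norm_sq (hess f u) d"
    "mat_norm_sq (hess f u) d \<le> smoothness_const f C * (norm d)\<^sup>2" by auto
qed

lemma strong_convexity_le_smoothness:
  assumes C: "compact C" "C \<subseteq> edom f" "C \<noteq> {}"
  shows "strong_convexity_const f C \<le> smoothness_const f C"
proof -
  obtain u where "u \<in> C" using C by blast
  \<comment> \<open>Any unit vector serves as test direction; \<open>undefined\<close> merely names
    some coordinate.\<close>
  from mat_norm_sq_hess_bounds[OF C(1,2) this, of "axis undefined 1"]
  show ?thesis by (simp add: norm_axis_1)
qed

section \<open>Restriction to lines: tangent inequality and Taylor expansion\<close>

lemma DERIV_along_line:
  assumes "x + t *\<^sub>R d \<in> edom f"
  shows "((\<lambda>t. rpart f (x + t *\<^sub>R d)) has_real_derivative grad f (x + t *\<^sub>R d) \<bullet> d) (at t)"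
    and "((\<lambda>t. grad f (x + t *\<^sub>R d) \<bullet> d) has_real_derivative
          mat_norm_sq (hess f (x + t *\<^sub>R d)) d) (at t)"
proof -
  have l: "((\<lambda>t. x + t *\<^sub>R d) has_derivative (\<lambda>s. s *\<^sub>R d)) (at t)"
    by (auto intro!: derivative_eq_intros)
  have g: "(rpart f has_derivative (\<lambda>h. h \<bullet> grad f (x + t *\<^sub>R d))) (at (x + t *\<^sub>R d))"
    using GDERIV_grad[OF assms] by (simp add: gderiv_def)
  show "((\<lambda>t. rpart f (x + t *\<^sub>R d)) has_real_derivative grad f (x + t *\<^sub>R d) \<bullet> d) (at t)"
    using has_derivative_compose[OF l g] 
    by (simp add: has_field_derivative_def inner_commute[of d] mult_commute_abs)
  show "((\<lambda>t. grad f (x + t *\<^sub>R d) \<bullet> d) has_real_derivative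
          mat_norm_sq (hess f (x + t *\<^sub>R d)) d) (at t)"
    using has_derivative_inner_left[OF has_derivative_compose[OF l has_derivative_grad[OF assms]], of d]
    by (simp add: has_field_derivative_def mat_norm_sq_def matrix_vector_mult_scaleR 
        mult_commute_abs)
qed

text \<open>The one-variable tangent inequality on the line through \<open>x\<close> and
  \<open>y\<close>. The parameters that stay in the domain form an open convex set, so
  \<open>0\<close> is interior as required.\<close>

lemma above_tangent:
  assumes x: "x \<in> edom f" and y: "y \<in> edom f"
  shows "rpart f x + grad f x \<bullet> (y - x) \<le> rpart f y"
proof -
  let ?l = "\<lambda>t::real. x + t *\<^sub>R (y - x)"
  let ?A = "?l -` edom f"
  have conv: "convex_on ?A (\<lambda>t. rpart f (?l t))"
  proof -
    have e: "?l (u * s + v * t) = u *\<^sub>R ?l s + v *\<^sub>R ?l t" if "u + v = 1" for u v s t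
    proof -
      have "u *\<^sub>R ?l s + v *\<^sub>R ?l t = (u + v) *\<^sub>R x + (u * s + v * t) *\<^sub>R (y - x)" 
        by (simp add: algebra_simps)
      thus ?thesis using that by simp
    qed
    have "convex ?A"
      by (rule convexI) (use convex_rpart e in \<open>auto simp: convex_on_def dest: convexD\<close>)
    thus ?thesis using convex_rpart by (auto simp: convex_on_def e)
  qed
  have op: "open ?A" by (intro open_vimage open_dom continuous_intros)
  have "0 \<in> interior ?A" "1 \<in> ?A" using x y op by (auto simp: interior_open)
  moreover have "connected ?A" using conv by (simp add: convex_on_def convex_connected)
  moreover have "((\<lambda>t. rpart f (?l t)) has_field_derivative grad f x \<bullet> (y - x)) (at 0 within ?A)"
    using DERIV_along_line(1)[of x 0 "y - x"] x by (auto intro: has_field_derivative_at_within)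
  ultimately have "rpart f (?l 1) - rpart f (?l 0) \<ge> (grad f x \<bullet> (y - x)) * (1 - 0)"
    using convex_on_imp_above_tangent[OF conv] by blast
  thus ?thesis by simp
qed

text \<open>Lagrange remainder along the segment. Convexity keeps the intermediate point in
  \<open>C\<close>, so Hessian bounds that hold only on \<open>C\<close> apply to it.\<close>

lemma second_order_expansion:
  assumes C: "convex C" "C \<subseteq> edom f" and x: "x \<in> C" and y: "y \<in> C"
  obtains u where "u \<in> C"
    "rpart f y = rpart f x + grad f x \<bullet> (y - x) + mat_norm_sq (hess f u) (y - x) / 2"
proof -
  let ?l = "\<lambda>t::real. x + t *\<^sub>R (y - x)"
  have l: "?l t \<in> C" if "0 \<le> t" "t \<le> 1" for t
  proof -
    have "?l t = (1 - t) *\<^sub>R x + t *\<^sub>R y" by (simp add: algebra_simps)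
    thus ?thesis using convexD_alt[OF C(1) x y that] by simp
  qed
  \<comment> \<open>The derivatives of orders 0, 1 and 2 along the segment, indexed in the form that
    \<open>Taylor_up\<close> expects.\<close>
  define D where "D m t = (if m = 0 then rpart f (?l t) else if m = 1 then grad f (?l t) \<bullet> (y - x)
      else mat_norm_sq (hess f (?l t)) (y - x))" for m :: nat and t
  have "\<exists>t>0. t < 1 \<and> D 0 1 = (\<Sum>m<2. (D m 0 / fact m) * (1 - 0)^m) + (D 2 t / fact 2) * (1 - 0)^2"
  proof (rule Taylor_up[where b = 1])
    show "\<forall>m t. m < 2 \<and> 0 \<le> t \<and> t \<le> 1 \<longrightarrow> DERIV (D m) t :> D (Suc m) t"
    proof (intro allI impI)
      fix m :: nat and t :: real assume *: "m < 2 \<and> 0 \<le> t \<and> t \<le> 1"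
      hence "?l t \<in> edom f" using l C(2) by blast
      note d = DERIV_along_line[OF this]
      from * have "m = 0 \<or> m = 1" by auto
      thus "DERIV (D m) t :> D (Suc m) t" using d by (auto simp: D_def[abs_def])
    qed
  qed auto
  then obtain t where t: "0 < t" "t < 1" 
    "D 0 1 = (\<Sum>m<2. (D m 0 / fact m) * (1 - 0)^m) + (D 2 t / fact 2) * (1 - 0)^2" by blast
  show thesis by (rule that[OF l[of t]]) (use t in \<open>auto simp: D_def numeral_2_eq_2\<close>)
qed

end

subsection \<open>Backtracking on the initial level set\<close>

text \<open>Rule induction with the invariant \<open>0 < K \<le> B\<close>: by the last hypothesis a
  rejected estimate can be multiplied by \<open>\<tau>\<close> without exceeding
  \<open>B\<close>.\<close>

lemma bt_loop_result:
  assumes "bt_loop f \<tau> x d \<gamma>max K \<gamma> K'" and "0 < K" "K \<le> B" "1 < \<tau>"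
    and "\<And>K. 0 < K \<Longrightarrow> bt_reject f x d \<gamma>max K \<Longrightarrow> \<tau> * K \<le> B"
  shows "0 < K' \<and> K' \<le> B \<and> \<gamma> = bt_gamma f x d \<gamma>max K' \<and> \<not> bt_reject f x d \<gamma>max K'"
  using assms by induction auto

section \<open>The optimization problem and its initial level set\<close>

locale fw_problem = smooth_convex f for f :: "real^'n \<Rightarrow> ereal" +
  fixes X :: "(real^'n) set" and \<tau> Linit :: real and x0 xstar :: "real^'n"
  assumes polytope: "polytope X" and diameter_pos: "diameter X > 0"
    and x0_vertex: "x0 \<in> vertices X" and x0_edom: "x0 \<in> edom f"
    and xstar_min: "is_arg_min f (\<lambda>x. x \<in> X) xstar"
    and tau: "\<tau> > 1" and Linit: "Linit > 0"
begin

definition L0 :: "(real^'n) set" where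
  "L0 = {x \<in> edom f \<inter> X. f x \<le> f x0}"

definition mu :: real where "mu = strong_convexity_const f L0"

definition Lf :: real where "Lf = smoothness_const f L0"

definition Lt :: real where "Lt = max (\<tau> * Lf) Linit"

definition rate :: real where
  "rate = 1 - mu / (4 * Lt) * (pyramidal_width X / diameter X)\<^sup>2"

definition gap :: "real^'n \<Rightarrow> real" where
  "gap x = rpart f x - rpart f xstar"

lemma x0_in: "x0 \<in> X"
  using x0_vertex vertices_subset by blast

lemma L0_eq: "L0 = X \<inter> {x. f x \<le> ereal (rpart f x0)}"
  using ereal_rpart[OF x0_edom] le_ereal_imp_edom by (auto simp: L0_def)

lemma L0_iff: "x \<in> L0 \<longleftrightarrow> x \<in> X \<and> x \<in> edom f \<and> rpart f x \<le> rpart f x0"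
  using ereal_rpart[of x] ereal_rpart[OF x0_edom] by (auto simp: L0_def)

lemma compact_L0: "compact L0"
  unfolding L0_eq by (intro compact_Int_closed closed_sublevel polytope_imp_compact polytope)

lemma convex_L0: "convex L0"
  unfolding L0_eq by (intro convex_Int convex_sublevel polytope_imp_convex polytope)

lemma L0_edom: "L0 \<subseteq> edom f" by (auto simp: L0_def)

lemma x0_L0: "x0 \<in> L0" using x0_in x0_edom by (simp add: L0_iff)

lemma xstar_L0: "xstar \<in> L0"
proof -
  have "xstar \<in> X" "f xstar \<le> f x0" using xstar_min x0_in by (auto simp: is_arg_min_def not_less)
  thus ?thesis unfolding L0_eq using ereal_rpart[OF x0_edom] by simp
qed

lemma gap_nonneg:
  assumes "x \<in> L0" shows "0 \<le> gap x"
proof -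
  have "f xstar \<le> f x" using assms xstar_min by (auto simp: is_arg_min_def not_less L0_def)
  thus ?thesis using assms xstar_L0 L0_edom ereal_rpart by (auto simp: gap_def subset_iff)
qed

lemma gap_le_gap_x0: "x \<in> L0 \<Longrightarrow> gap x \<le> gap x0"
  by (simp add: gap_def L0_iff)

lemma Lt_pos: "0 < Lt" using Linit by (simp add: Lt_def)

text \<open>The sign of \<open>Lf\<close> is left open: multiplication by \<open>\<tau>\<close>
  would lower a negative value, but then \<open>Linit > 0\<close> already exceeds it.\<close>

lemma Lf_le_Lt: "Lf \<le> Lt"
proof (cases "0 \<le> Lf")
  case True
  hence "Lf \<le> \<tau> * Lf" using tau by (simp add: mult_le_cancel_right1)
  thus ?thesis by (simp add: Lt_def)
next
  case False
  thus ?thesis using Linit by (simp add: Lt_def)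
qed

text \<open>The subtracted term lies between 0 and 1/4 because \<open>mu \<le> Lf \<le> Lt\<close>
  and the width is at most the diameter. The lower bound absorbs the factor 1/2 of a full
  Frank-Wolfe step; both together make powers of the rate decreasing.\<close>

lemma rate_bounds:
  assumes "0 \<le> mu" shows "3/4 \<le> rate" "rate \<le> 1"
proof -
  have "mu \<le> Lf" unfolding mu_def Lf_def
    by (rule strong_convexity_le_smoothness) (use compact_L0 L0_edom x0_L0 in auto)
  hence m: "mu / (4 * Lt) \<le> 1/4" "0 \<le> mu / (4 * Lt)"
    using Lf_le_Lt Lt_pos assms by (simp_all add: divide_simps)
  have "0 \<le> pyramidal_width X / diameter X" "pyramidal_width X / diameter X \<le> 1"
    using pyramidal_width_nonneg_le_diameter[OF polytope diameter_pos] diameter_pos by simp_all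
  hence d: "0 \<le> (pyramidal_width X / diameter X)\<^sup>2" "(pyramidal_width X / diameter X)\<^sup>2 \<le> 1"
    by (simp_all add: power_le_one)
  from mult_mono[OF m(1) d(2)] show "3/4 \<le> rate" using d by (simp add: rate_def)
  from mult_nonneg_nonneg[OF m(2) d(1)] show "rate \<le> 1" by (simp add: rate_def)
qed

lemma descent_lemma:
  assumes "x \<in> L0" "y \<in> L0"
  shows "rpart f y \<le> rpart f x + grad f x \<bullet> (y - x) + Lf / 2 * (norm (y - x))\<^sup>2"
proof -
  obtain u where "u \<in> L0" "rpart f y = rpart f x + grad f x \<bullet> (y - x) + mat_norm_sq (hess f u) (y - x) / 2"
    using second_order_expansion[OF convex_L0 L0_edom assms] .
  with mat_norm_sq_hess_bounds(2)[OF compact_L0 L0_edom, of u "y - x"] show ?thesis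
    by (simp add: Lf_def)
qed

lemma strong_convexity:
  assumes "x \<in> L0" "y \<in> L0"
  shows "rpart f x + grad f x \<bullet> (y - x) + mu / 2 * (norm (y - x))\<^sup>2 \<le> rpart f y"
proof -
  obtain u where "u \<in> L0" "rpart f y = rpart f x + grad f x \<bullet> (y - x) + mat_norm_sq (hess f u) (y - x) / 2"
    using second_order_expansion[OF convex_L0 L0_edom assms] .
  with mat_norm_sq_hess_bounds(1)[OF compact_L0 L0_edom, of u "y - x"] show ?thesis
    by (simp add: mu_def)
qed

text \<open>The trial point stays in \<open>L0\<close>: the segment from \<open>x\<close> cannot leave \<open>L0\<close> at a step \<open>s\<close> shorter than
  the trial step, since there the quadratic upper bound, valid on \<open>L0\<close>, keeps \<open>f\<close> strictly below
  its value at \<open>x\<close>.\<close>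
lemma segment_in_L0:
  assumes x: "x \<in> L0" and d: "d \<noteq> 0" and desc: "grad f x \<bullet> d < 0" and K: "0 < K" "Lf \<le> K"
    and \<gamma>: "0 \<le> \<gamma>" "\<gamma> \<le> - (grad f x \<bullet> d) / (K * (norm d)\<^sup>2)"
    and seg: "\<And>s. 0 \<le> s \<Longrightarrow> s \<le> \<gamma> \<Longrightarrow> x + s *\<^sub>R d \<in> X"
  shows "x + \<gamma> *\<^sub>R d \<in> L0"
proof -
  let ?\<phi> = "\<lambda>t. rpart f (x + t *\<^sub>R d)"
  \<comment> \<open>The step lengths ending in \<open>L0\<close>. Compactness provides a largest
    one, \<open>s\<close>; if it were less than \<open>\<gamma>\<close>, a longer one would be
    found.\<close>
  define T where "T = {0..\<gamma>} \<inter> (\<lambda>s. x + s *\<^sub>R d) -` L0"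
  have "compact T" unfolding T_def
    by (intro compact_Int_closed closed_vimage compact_imp_closed compact_L0 continuous_intros compact_Icc)
  moreover have "T \<noteq> {}"
  proof -
    have "0 \<in> T" using x \<gamma>(1) by (simp add: T_def)
    thus ?thesis by blast
  qed
  ultimately obtain s where s: "s \<in> T" and smax: "\<And>t. t \<in> T \<Longrightarrow> t \<le> s"
    using compact_attains_sup[of T] by metis
  have s0: "0 \<le> s" "s \<le> \<gamma>" and sL: "x + s *\<^sub>R d \<in> L0" using s by (auto simp: T_def)
  have dom: "x + s *\<^sub>R d \<in> edom f" using sL L0_edom by blast
  have "s = \<gamma>"
  proof (rule ccontr)
    assume "s \<noteq> \<gamma>"
    hence sg: "s < \<gamma>" using s0 by simp
    \<comment> \<open>At \<open>s = 0\<close> the quadratic bound yields no strict decrease, so the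
      negative slope is used; for \<open>s > 0\<close> the bound is strict at \<open>s\<close> and
      continuity extends it to the right.\<close>
    have d1: "eventually (\<lambda>t. ?\<phi> t < rpart f x) (at_right s)"
    proof (cases "s = 0")
      case True
      have "DERIV ?\<phi> 0 :> grad f x \<bullet> d"
        using DERIV_along_line(1)[of x 0 d] x L0_edom by auto
      from DERIV_neg_dec_right[OF this desc] obtain e where "e > 0" "\<And>h. 0 < h \<Longrightarrow> h < e \<Longrightarrow> ?\<phi> h < ?\<phi> 0"
        by auto
      thus ?thesis unfolding True eventually_at_right_field by (intro exI[of _ e]) auto
    next
      case False
      hence sp: "0 < s" using s0 by simp
      have "0 < K * (norm d)\<^sup>2" using d K(1) by simp
      moreover have "s < - (grad f x \<bullet> d) / (K * (norm d)\<^sup>2)" using sg \<gamma>(2) by linarith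
      ultimately have "s * (K * (norm d)\<^sup>2) < - (grad f x \<bullet> d)"
        by (simp only: pos_less_divide_eq)
      from mult_strict_left_mono[OF this sp]
      have "K * (s\<^sup>2 * (norm d)\<^sup>2) < - (s * (grad f x \<bullet> d))" 
        by (simp add: power2_eq_square mult_ac)
      moreover have "Lf * (s\<^sup>2 * (norm d)\<^sup>2) \<le> K * (s\<^sup>2 * (norm d)\<^sup>2)"
        using K by (intro mult_right_mono) auto
      moreover have "0 \<le> K * (s\<^sup>2 * (norm d)\<^sup>2)" using K by simp
      ultimately have "?\<phi> s < rpart f x"
        using descent_lemma[OF x sL] by (simp add: power_mult_distrib)
      moreover have "isCont ?\<phi> s" using DERIV_along_line(1)[OF dom] DERIV_isCont by blast
      hence "(?\<phi> \<longlongrightarrow> ?\<phi> s) (at_right s)"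
        by (simp add: isCont_def filterlim_at_split)
      ultimately show ?thesis using order_tendstoD(2)[of ?\<phi>] by blast
    qed
    have d2: "eventually (\<lambda>t. x + t *\<^sub>R d \<in> edom f) (at_right s)"
    proof -
      have "((\<lambda>t. x + t *\<^sub>R d) \<longlongrightarrow> x + s *\<^sub>R d) (at_right s)" by (intro tendsto_intros)
      from topological_tendstoD[OF this open_dom dom] show ?thesis .
    qed
    have d3: "eventually (\<lambda>t. s < t \<and> t < \<gamma>) (at_right s)"
      using sg unfolding eventually_at_right_field by blast
    obtain t where t: "?\<phi> t < rpart f x" "x + t *\<^sub>R d \<in> edom f" "s < t" "t < \<gamma>"
      using eventually_happens'[OF _ eventually_conj[OF d1 eventually_conj[OF d2 d3]]]
      by (auto simp: trivial_limit_at_right_real)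
    hence "t \<in> T" using s0 seg[of t] x by (auto simp: T_def L0_iff)
    thus False using smax t by force
  qed
  thus ?thesis using sL by simp
qed

text \<open>For \<open>K \<ge> Lf\<close> the trial point lies in \<open>L0\<close>, hence in the
  domain, and there the descent lemma implies the acceptance test.\<close>

lemma not_bt_reject:
  assumes x: "x \<in> L0" and desc: "grad f x \<bullet> d \<le> 0" and K: "0 < K" "Lf \<le> K" and "0 \<le> \<gamma>max"
    and seg: "\<And>s. 0 \<le> s \<Longrightarrow> s \<le> \<gamma>max \<Longrightarrow> x + s *\<^sub>R d \<in> X"
  shows "\<not> bt_reject f x d \<gamma>max K"
proof -
  define \<gamma> where "\<gamma> = bt_gamma f x d \<gamma>max K"
  have "x + \<gamma> *\<^sub>R d \<in> L0"
  proof (cases "d = 0 \<or> grad f x \<bullet> d = 0")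
    case True
    \<comment> \<open>Without strict descent \<open>bt_gamma\<close> is zero, and the trial point is
      \<open>x\<close> itself.\<close>
    hence "\<gamma> *\<^sub>R d = 0" using \<open>0 \<le> \<gamma>max\<close> by (auto simp: \<gamma>_def bt_gamma_def)
    thus ?thesis using x by (simp del: scaleR_eq_0_iff)
  next
    case False
    hence "0 \<le> \<gamma>" "\<gamma> \<le> - (grad f x \<bullet> d) / (K * (norm d)\<^sup>2)" "\<gamma> \<le> \<gamma>max"
      using desc K \<open>0 \<le> \<gamma>max\<close> by (auto simp: \<gamma>_def bt_gamma_def divide_le_0_iff)
    thus ?thesis using segment_in_L0[of x d K \<gamma>] False x desc K seg by force
  qed
  note L = this
  have "Lf * (\<gamma>\<^sup>2 * (norm d)\<^sup>2) \<le> K * (\<gamma>\<^sup>2 * (norm d)\<^sup>2)"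
    using K by (intro mult_right_mono) auto
  hence "rpart f (x + \<gamma> *\<^sub>R d) - rpart f x \<le> K * \<gamma>\<^sup>2 / 2 * (norm d)\<^sup>2 + \<gamma> * (grad f x \<bullet> d)"
    using descent_lemma[OF x L] by (simp add: power_mult_distrib)
  moreover have "x + \<gamma> *\<^sub>R d \<in> edom f" "x \<in> edom f" using L x L0_edom by auto
  ultimately show ?thesis
    unfolding bt_reject_def \<gamma>_def[symmetric] Let_def by (simp add: ereal_rpart not_less)
qed

lemma backtrack_progress:
  assumes bt: "backtrack f \<tau> \<eta> x d L \<gamma>max \<gamma> L'" and \<eta>: "0 < \<eta>" and L: "0 < L" "L \<le> Lt"
    and x: "x \<in> L0" and desc: "grad f x \<bullet> d \<le> 0" and \<gamma>max: "0 \<le> \<gamma>max"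
    and seg: "\<And>s. 0 \<le> s \<Longrightarrow> s \<le> \<gamma>max \<Longrightarrow> x + s *\<^sub>R d \<in> X"
    and D: "norm d \<le> diameter X"
  shows "0 < L'" "L' \<le> Lt" "0 \<le> \<gamma>" "\<gamma> \<le> \<gamma>max" "x + \<gamma> *\<^sub>R d \<in> L0"
    and "gap (x + \<gamma> *\<^sub>R d) \<le> gap x"
    and "(\<gamma> = \<gamma>max \<and> gap (x + \<gamma> *\<^sub>R d) \<le> gap x - \<gamma>max * - (grad f x \<bullet> d) / 2)
      \<or> (grad f x \<bullet> d)\<^sup>2 \<le> (gap x - gap (x + \<gamma> *\<^sub>R d)) * (2 * Lt * (diameter X)\<^sup>2)"
proof -
  \<comment> \<open>A rejected estimate is below \<open>Lf\<close>, so one multiplication by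
    \<open>\<tau>\<close> leaves it below \<open>\<tau> * Lf\<close>: the first argument of the
    maximum \<open>Lt\<close>.\<close>
  have rej: "\<tau> * K \<le> Lt" if "0 < K" "bt_reject f x d \<gamma>max K" for K
  proof -
    have "K < Lf" using not_bt_reject[OF x desc that(1) _ \<gamma>max seg] that(2) by force
    thus ?thesis using tau by (simp add: Lt_def le_max_iff_disj)
  qed
  obtain K0 where K0: "\<eta> * L \<le> K0" "K0 \<le> L" "bt_loop f \<tau> x d \<gamma>max K0 \<gamma> L'"
    using bt by (auto simp: backtrack_def)
  have "0 < K0" using K0(1) \<eta> L(1) by (meson less_le_trans mult_pos_pos)
  from bt_loop_result[OF K0(3) this _ tau rej, simplified] K0(2) L(2)
  have res: "0 < L'" "L' \<le> Lt" "\<gamma> = bt_gamma f x d \<gamma>max L'" "\<not> bt_reject f x d \<gamma>max L'" by auto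
  show "0 < L'" "L' \<le> Lt" by fact+
  define G where "G = - (grad f x \<bullet> d)"
  define n where "n = L' * (norm d)\<^sup>2"
  have G: "0 \<le> G" using desc by (simp add: G_def)
  have n: "0 \<le> n" using res(1) by (simp add: n_def)
  have \<gamma>: "\<gamma> = (if d = 0 then 0 else min (G / n) \<gamma>max)"
    using res(3) by (simp add: bt_gamma_def G_def n_def)
  show \<gamma>0: "0 \<le> \<gamma>" "\<gamma> \<le> \<gamma>max" using G n \<gamma>max by (auto simp: \<gamma>)
  have dom: "x \<in> edom f" "x + \<gamma> *\<^sub>R d \<in> edom f"
    using x L0_edom res(4) unfolding bt_reject_def res(3)[symmetric] Let_def by auto
  have dec: "rpart f (x + \<gamma> *\<^sub>R d) \<le> rpart f x + n * \<gamma>\<^sup>2 / 2 - \<gamma> * G"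
    using res(4) dom unfolding bt_reject_def res(3)[symmetric] Let_def
    by (simp add: ereal_rpart not_less G_def n_def mult_ac)
  \<comment> \<open>The step never exceeds \<open>G / n\<close>, the minimizer of the quadratic
    model; the form without division also covers \<open>d = 0\<close>.\<close>
  have \<gamma>n: "n * \<gamma> \<le> G"
  proof (cases "d = 0")
    case False
    hence "0 < n" using res(1) by (simp add: n_def)
    moreover have "\<gamma> \<le> G / n" using False by (simp add: \<gamma>)
    ultimately show ?thesis by (simp add: field_simps)
  qed (use G in \<open>simp add: \<gamma>\<close>)
  \<comment> \<open>Acceptance grants the decrease
    \<open>\<gamma> * G - n * \<gamma>\<^sup>2 / 2\<close>, and \<open>n * \<gamma> \<le> G\<close>
    turns it into half of the linear decrease.\<close>
  have half: "gap (x + \<gamma> *\<^sub>R d) \<le> gap x - \<gamma> * G / 2"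
    using dec mult_left_mono[OF \<gamma>n \<gamma>0(1)] by (simp add: gap_def power2_eq_square mult_ac)
  have "0 \<le> \<gamma> * G" using \<gamma>0 G by simp
  thus gap_le: "gap (x + \<gamma> *\<^sub>R d) \<le> gap x" using half by simp
  thus "x + \<gamma> *\<^sub>R d \<in> L0"
    using x dom seg[OF \<gamma>0] by (simp add: L0_iff gap_def)
  show "(\<gamma> = \<gamma>max \<and> gap (x + \<gamma> *\<^sub>R d) \<le> gap x - \<gamma>max * - (grad f x \<bullet> d) / 2)
      \<or> (grad f x \<bullet> d)\<^sup>2 \<le> (gap x - gap (x + \<gamma> *\<^sub>R d)) * (2 * Lt * (diameter X)\<^sup>2)"
  proof (cases "\<gamma> = \<gamma>max")
    case True
    thus ?thesis using half by (simp add: G_def)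
  next
    case False
    \<comment> \<open>An uncut step along a nonzero direction equals \<open>G / n\<close>; for
      \<open>d = 0\<close> both sides vanish.\<close>
    have "G\<^sup>2 = \<gamma> * G * n" 
    proof (cases "d = 0")
      case True
      thus ?thesis by (simp add: G_def)
    next
      case d: False
      hence "0 < n" using res(1) by (simp add: n_def)
      moreover have "\<gamma> = G / n" using False d by (auto simp: \<gamma> min_def split: if_splits)
      ultimately show ?thesis by (simp add: power2_eq_square)
    qed
    also have "\<dots> \<le> 2 * (gap x - gap (x + \<gamma> *\<^sub>R d)) * n"
      using half n by (intro mult_right_mono) auto
    also have "\<dots> \<le> 2 * (gap x - gap (x + \<gamma> *\<^sub>R d)) * (Lt * (diameter X)\<^sup>2)"
      unfolding n_def using gap_le res(1,2) D
      by (intro mult_left_mono mult_mono power_mono) auto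
    finally show ?thesis by (simp add: G_def algebra_simps)
  qed
qed

text \<open>The unknown distance \<open>e\<close> to the minimizer is eliminated. Strong convexity
  gives \<open>gap x \<le> p - mu / 2 * e\<^sup>2\<close>, and since
  \<open>(p - mu * e\<^sup>2)\<^sup>2\<close> is nonnegative,
  \<open>2 * mu * gap x * e\<^sup>2 \<le> p\<^sup>2\<close>. The pyramidal width bounds
  \<open>p\<close> by a multiple of \<open>e\<close>, so \<open>e\<^sup>2\<close> cancels. Nothing
  is divided by \<open>mu\<close>, so \<open>mu = 0\<close> is included.\<close>

lemma pyramidal_gap_bound:
  assumes mu: "0 \<le> mu" and x: "x \<in> L0" and S: "S \<in> proper_supports x (vertices X)"
    and v: "\<And>z. z \<in> X \<Longrightarrow> grad f x \<bullet> v \<le> grad f x \<bullet> z"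
    and a: "\<And>z. z \<in> S \<Longrightarrow> grad f x \<bullet> z \<le> grad f x \<bullet> a"
  shows "(pyramidal_width X)\<^sup>2 * (2 * mu * gap x) \<le> (grad f x \<bullet> (a - v))\<^sup>2"
proof -
  define e where "e = norm (xstar - x)"
  define p where "p = - grad f x \<bullet> (xstar - x)"
  have h: "gap x \<le> p - mu / 2 * e\<^sup>2"
    using strong_convexity[OF x xstar_L0] by (simp add: gap_def p_def e_def)
  show ?thesis
  proof (cases "p > 0")
    case False
    have "0 \<le> mu / 2 * e\<^sup>2" using mu by simp
    hence "gap x \<le> 0" using h False by linarith
    hence "(pyramidal_width X)\<^sup>2 * (2 * mu * gap x) \<le> 0"
      using mu by (intro mult_nonneg_nonpos) auto
    thus ?thesis using zero_le_power2 order_trans by blast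
  next
    case True
    hence e0: "e > 0" by (auto simp: p_def e_def)
    have xX: "x \<in> X" "xstar \<in> X" using x xstar_L0 by (auto simp: L0_iff)
    have "pyramidal_width X * p \<le> e * (- grad f x \<bullet> (v - a))"
      unfolding p_def e_def
      by (rule pyramidal_width_bound[OF polytope S xX]) (use True v a in \<open>auto simp: p_def\<close>)
    hence 1: "pyramidal_width X * p \<le> e * (grad f x \<bullet> (a - v))" by (simp add: inner_diff_right)
    have "0 \<le> pyramidal_width X * p"
      using pyramidal_width_nonneg_le_diameter[OF polytope diameter_pos] True by simp
    from power_mono[OF 1 this, of 2]
    have 2: "(pyramidal_width X)\<^sup>2 * p\<^sup>2 \<le> e\<^sup>2 * (grad f x \<bullet> (a - v))\<^sup>2"
      by (simp add: power_mult_distrib)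
    have "2 * mu * gap x * e\<^sup>2 \<le> 2 * mu * (p - mu / 2 * e\<^sup>2) * e\<^sup>2"
      using h mu by (intro mult_right_mono mult_left_mono) auto
    also have "\<dots> \<le> p\<^sup>2"
      using zero_le_power2[of "p - mu * e\<^sup>2"] by (simp add: power2_eq_square algebra_simps)
    finally have "(pyramidal_width X)\<^sup>2 * (2 * mu * gap x * e\<^sup>2) \<le> (pyramidal_width X)\<^sup>2 * p\<^sup>2"
      by (intro mult_left_mono) auto
    with 2 have "e\<^sup>2 * ((pyramidal_width X)\<^sup>2 * (2 * mu * gap x)) \<le> e\<^sup>2 * (grad f x \<bullet> (a - v))\<^sup>2"
      by (simp add: mult_ac)
    thus ?thesis using e0 by (simp add: mult_le_cancel_left_pos)
  qed
qed

text \<open>Chains the lower bound \<open>2 * mu * gap x\<close> times the squared width, the factor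
  4 from squaring \<open>d\<close>, and the factor \<open>2 * Lt\<close> from \<open>dec\<close>;
  solving for \<open>gap y\<close> produces exactly \<open>rate\<close>.\<close>

lemma contraction:
  assumes mu: "0 \<le> mu" and x: "x \<in> L0" and S: "S \<in> proper_supports x (vertices X)"
    and v: "\<And>z. z \<in> X \<Longrightarrow> grad f x \<bullet> v \<le> grad f x \<bullet> z"
    and a: "\<And>z. z \<in> S \<Longrightarrow> grad f x \<bullet> z \<le> grad f x \<bullet> a" "a \<in> X"
    and d: "grad f x \<bullet> (a - v) \<le> 2 * - (grad f x \<bullet> d)"
    and dec: "(grad f x \<bullet> d)\<^sup>2 \<le> (gap x - gap y) * (2 * Lt * (diameter X)\<^sup>2)"
  shows "gap y \<le> rate * gap x"
proof -
  have "(grad f x \<bullet> (a - v))\<^sup>2 \<le> (2 * - (grad f x \<bullet> d))\<^sup>2"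
    using d v[OF a(2)] by (intro power_mono) (auto simp: inner_diff_right)
  with pyramidal_gap_bound[OF mu x S v a(1)] dec
  have "(pyramidal_width X)\<^sup>2 * (mu * gap x) \<le> (gap x - gap y) * (4 * Lt * (diameter X)\<^sup>2)"
    by (simp add: power_mult_distrib)
  moreover have "0 < 4 * Lt * (diameter X)\<^sup>2" using Lt_pos diameter_pos by simp
  ultimately have "(pyramidal_width X)\<^sup>2 * (mu * gap x) / (4 * Lt * (diameter X)\<^sup>2) \<le> gap x - gap y"
    by (simp add: pos_divide_le_eq)
  thus ?thesis by (simp add: rate_def power_divide algebra_simps)
qed

end

subsection \<open>Weights and active sets\<close>

text \<open>The sums run over a fixed set, later all vertices, and not over the active set. Weight
  updates then never change the index set, and the active set is recovered as the support.\<close>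

definition barycentric :: "'a::real_vector set \<Rightarrow> ('a \<Rightarrow> real) \<Rightarrow> 'a \<Rightarrow> bool" where
  "barycentric V w x \<longleftrightarrow>
     finite V \<and> (\<forall>u\<in>V. 0 \<le> w u) \<and> sum w V = 1 \<and> (\<Sum>u\<in>V. w u *\<^sub>R u) = x"

definition support_on :: "'a set \<Rightarrow> ('a \<Rightarrow> real) \<Rightarrow> 'a set" where
  "support_on V w = {u \<in> V. w u > 0}"

lemma sum_single_weight:
  fixes V :: "'a::real_vector set"
  assumes "finite V" "v \<in> V"
  shows "(\<Sum>u\<in>V. (if u = v then c else 0)) = (c::real)"
    and "(\<Sum>u\<in>V. (if u = v then c else 0) *\<^sub>R u) = c *\<^sub>R v"
proof -
  show "(\<Sum>u\<in>V. (if u = v then c else 0)) = c" using assms by simp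
  have "(\<Sum>u\<in>V. (if u = v then c else 0) *\<^sub>R u) = (\<Sum>u\<in>V. if u = v then c *\<^sub>R v else 0)"
    by (intro sum.cong) auto
  thus "(\<Sum>u\<in>V. (if u = v then c else 0) *\<^sub>R u) = c *\<^sub>R v" using assms by simp
qed

lemma barycentric_mem: "barycentric V w x \<Longrightarrow> convex X \<Longrightarrow> V \<subseteq> X \<Longrightarrow> x \<in> X"
  unfolding barycentric_def using convex_sum[of V X w "\<lambda>u. u"] by blast

lemma barycentric_support_on:
  assumes "barycentric V w x"
  shows "barycentric (support_on V w) w x"
proof -
  have V: "finite V" and sub: "support_on V w \<subseteq> V" and z: "\<forall>u\<in>V - support_on V w. w u = 0"
    using assms by (auto simp: barycentric_def support_on_def order.order_iff_strict)
  have "sum w (support_on V w) = 1"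
    using sum.mono_neutral_left[OF V sub z] assms by (simp add: barycentric_def)
  moreover have "(\<Sum>u\<in>support_on V w. w u *\<^sub>R u) = x"
    using sum.mono_neutral_left[OF V sub, of "\<lambda>u. w u *\<^sub>R u"] z assms by (simp add: barycentric_def)
  moreover have "finite (support_on V w)" using V sub finite_subset by blast
  ultimately show ?thesis by (auto simp: barycentric_def support_on_def)
qed

lemma support_on_proper_support:
  assumes "barycentric V w x"
  shows "support_on V w \<in> proper_supports x V"
  using barycentric_support_on[OF assms] by (auto simp: barycentric_def proper_supports_def support_on_def)

lemma barycentric_weight_le_1:
  assumes "barycentric V w x" "u \<in> V"
  shows "w u \<le> 1"
  using member_le_sum[of u V w] assms by (auto simp: barycentric_def)

text \<open>Protects the quotient \<open>w a / (1 - w a)\<close> of the away step from a zero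
  denominator.\<close>

lemma barycentric_weight_eq_1:
  assumes b: "barycentric V w x" and a: "a \<in> V" "w a = 1"
  shows "x = a"
proof -
  have V: "finite V" using b by (simp add: barycentric_def)
  have "sum w V = w a + sum w (V - {a})" using V a by (simp add: sum.remove)
  hence "sum w (V - {a}) = 0" using b a by (simp add: barycentric_def)
  hence "\<forall>u\<in>V - {a}. w u = 0"
    using b V by (subst (asm) sum_nonneg_eq_0_iff) (auto simp: barycentric_def)
  hence "(\<Sum>u\<in>V - {a}. w u *\<^sub>R u) = 0" by (intro sum.neutral) auto
  moreover have "x = w a *\<^sub>R a + (\<Sum>u\<in>V - {a}. w u *\<^sub>R u)"
    using b V a by (auto simp: barycentric_def sum.remove)
  ultimately show ?thesis using a by simp
qed

lemma barycentric_fw: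
  assumes b: "barycentric V w x" and v: "v \<in> V" and \<gamma>: "0 \<le> \<gamma>" "\<gamma> \<le> 1"
  shows "barycentric V (fw_weights \<gamma> v w) (x + \<gamma> *\<^sub>R (v - x))"
proof -
  have V: "finite V" using b by (simp add: barycentric_def)
  note s = sum_single_weight[OF V v]
  have "sum (fw_weights \<gamma> v w) V = 1"
    using b by (simp add: fw_weights_def sum.distrib sum_distrib_left[symmetric] s barycentric_def)
  moreover have "(\<Sum>u\<in>V. fw_weights \<gamma> v w u *\<^sub>R u) = (1 - \<gamma>) *\<^sub>R (\<Sum>u\<in>V. w u *\<^sub>R u) + \<gamma> *\<^sub>R v"
    unfolding fw_weights_def scaleR_left.add sum.distrib s(2) scaleR_sum_right by simp
  hence "(\<Sum>u\<in>V. fw_weights \<gamma> v w u *\<^sub>R u) = x + \<gamma> *\<^sub>R (v - x)"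
    using b by (simp add: barycentric_def algebra_simps)
  ultimately show ?thesis using b \<gamma> by (auto simp: barycentric_def fw_weights_def)
qed

text \<open>The bound on \<open>\<gamma>\<close> is the maximal step length cleared of its
  denominator; in this form it is precisely nonnegativity of the new weight of
  \<open>a\<close>.\<close>

lemma barycentric_away:
  assumes b: "barycentric V w x" and a: "a \<in> V" and \<gamma>: "0 \<le> \<gamma>" "\<gamma> * (1 - w a) \<le> w a"
  shows "barycentric V (away_weights \<gamma> a w) (x + \<gamma> *\<^sub>R (x - a))"
proof -
  have V: "finite V" using b by (simp add: barycentric_def)
  note s = sum_single_weight[OF V a]
  have "sum (away_weights \<gamma> a w) V = 1"
    using b by (simp add: away_weights_def sum_subtractf sum_distrib_left[symmetric] s barycentric_def)
  moreover have "(\<Sum>u\<in>V. away_weights \<gamma> a w u *\<^sub>R u) = (1 + \<gamma>) *\<^sub>R (\<Sum>u\<in>V. w u *\<^sub>R u) - \<gamma> *\<^sub>R a"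
    unfolding away_weights_def scaleR_left.diff sum_subtractf s(2) scaleR_sum_right by simp
  hence "(\<Sum>u\<in>V. away_weights \<gamma> a w u *\<^sub>R u) = x + \<gamma> *\<^sub>R (x - a)"
    using b by (simp add: barycentric_def algebra_simps)
  moreover have "0 \<le> away_weights \<gamma> a w u" if "u \<in> V" for u
    using that b \<gamma> by (auto simp: barycentric_def away_weights_def algebra_simps)
  ultimately show ?thesis using V by (simp add: barycentric_def)
qed

lemma barycentric_pairwise:
  assumes b: "barycentric V w x" and a: "a \<in> V" "s \<in> V" and \<gamma>: "0 \<le> \<gamma>" "\<gamma> \<le> w a"
  shows "barycentric V (pairwise_weights \<gamma> a s w) (x + \<gamma> *\<^sub>R (s - a))"
proof -
  have V: "finite V" using b by (simp add: barycentric_def)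
  note s = sum_single_weight[OF V a(1)] sum_single_weight[OF V a(2)]
  have "sum (pairwise_weights \<gamma> a s w) V = 1"
    using b by (simp add: pairwise_weights_def sum.distrib sum_subtractf s barycentric_def)
  moreover have "(\<Sum>u\<in>V. pairwise_weights \<gamma> a s w u *\<^sub>R u) = x + \<gamma> *\<^sub>R (s - a)"
    using b unfolding pairwise_weights_def scaleR_left.diff scaleR_left.add sum_subtractf sum.distrib s(2,4)
    by (simp add: barycentric_def algebra_simps)
  moreover have "0 \<le> pairwise_weights \<gamma> a s w u" if "u \<in> V" for u
    using that b \<gamma> by (auto simp: barycentric_def pairwise_weights_def)
  ultimately show ?thesis using V by (simp add: barycentric_def)
qed

lemma card_support_fw:
  assumes "finite V" "0 \<le> \<gamma>" "\<gamma> \<le> 1" "\<forall>u\<in>V. 0 \<le> w u"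
  shows "card (support_on V (fw_weights \<gamma> v w)) \<le> card (support_on V w) + 1"
proof -
  have "w u > 0 \<or> u = v" if "u \<in> support_on V (fw_weights \<gamma> v w)" for u
  proof (rule ccontr)
    assume "\<not> ?thesis"
    hence "w u = 0" "u \<noteq> v" using that assms by (auto simp: support_on_def)
    thus False using that by (simp add: support_on_def fw_weights_def)
  qed
  hence sub: "support_on V (fw_weights \<gamma> v w) \<subseteq> insert v (support_on V w)"
    by (auto simp: support_on_def)
  have "finite (support_on V w)" using assms by (simp add: support_on_def)
  from card_mono[OF _ sub] card_insert_le_m1 card_insert_if[OF this, of v] this
  show ?thesis by (auto split: if_splits)
qed

lemma support_away_subset:
  assumes "0 \<le> \<gamma>"
  shows "support_on V (away_weights \<gamma> a w) \<subseteq> support_on V w"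
proof
  fix u assume u: "u \<in> support_on V (away_weights \<gamma> a w)"
  hence "0 < (1 + \<gamma>) * w u"
    using assms by (auto simp: support_on_def away_weights_def split: if_splits)
  hence "0 < w u" using assms by (simp add: zero_less_mult_iff)
  thus "u \<in> support_on V w" using u by (simp add: support_on_def)
qed

text \<open>Weight moves to a vertex that is already active, so none can enter.\<close>

lemma support_pairwise_subset:
  assumes "0 \<le> \<gamma>" "s \<in> support_on V w"
  shows "support_on V (pairwise_weights \<gamma> a s w) \<subseteq> support_on V w"
  using assms by (auto simp: support_on_def pairwise_weights_def split: if_splits)

lemma card_support_drop:
  assumes "finite V" "support_on V w' \<subseteq> support_on V w" "a \<in> support_on V w" "w' a = 0"
  shows "card (support_on V w') < card (support_on V w)"
proof (rule psubset_card_mono)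
  have "a \<notin> support_on V w'" using assms(4) by (simp add: support_on_def)
  thus "support_on V w' \<subset> support_on V w" using assms(2,3) by blast
qed (use assms(1) in \<open>simp add: support_on_def\<close>)

subsection \<open>Progress of a single iteration\<close>

context fw_problem
begin

definition admissible :: "(real^'n) fw_state \<Rightarrow> bool" where
  "admissible \<sigma> \<longleftrightarrow> iterate \<sigma> \<in> L0 \<and> barycentric (vertices X) (weight \<sigma>) (iterate \<sigma>) \<and>
     active \<sigma> = support_on (vertices X) (weight \<sigma>) \<and> 0 < estimate \<sigma> \<and> estimate \<sigma> \<le> Lt"

text \<open>The second alternative is a drop step, which may hardly decrease \<open>f\<close>.\<close>
definition progress :: "(real^'n) fw_state \<Rightarrow> (real^'n) fw_state \<Rightarrow> bool" where
  "progress \<sigma> \<sigma>' \<longleftrightarrow>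
     gap (iterate \<sigma>') \<le> rate * gap (iterate \<sigma>) \<and> card (active \<sigma>') \<le> card (active \<sigma>) + 1 \<or>
     gap (iterate \<sigma>') \<le> gap (iterate \<sigma>) \<and> card (active \<sigma>') < card (active \<sigma>)"

lemma finite_vert: "finite (vertices X)"
  by (rule finite_vertices[OF polytope])

lemma barycentric_in_X: "barycentric (vertices X) w x \<Longrightarrow> x \<in> X"
  by (rule barycentric_mem[OF _ polytope_imp_convex[OF polytope] vertices_subset])

lemma norm_diff_le_diameter: "x \<in> X \<Longrightarrow> y \<in> X \<Longrightarrow> norm (x - y) \<le> diameter X"
  using diameter_bounded_bound[OF polytope_imp_bounded[OF polytope]] by (simp add: dist_norm)

text \<open>Assumption \<open>d\<close> is what the two selection rules have in common. In B-AFW,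
  \<open>g \<bullet> (a - v)\<close> splits at \<open>x\<close> and the Frank-Wolfe part is the
  larger one; in B-BPCG it splits at \<open>s\<close>, and both parts are at most
  \<open>g \<bullet> (x - v)\<close> because
  \<open>g \<bullet> s \<le> g \<bullet> x\<close>.\<close>

lemma fw_step_progress:
  assumes adm: "admissible \<sigma>" and x: "x = iterate \<sigma>" and w: "w = weight \<sigma>"
    and v: "v \<in> vertices X" "\<And>z. z \<in> X \<Longrightarrow> grad f x \<bullet> v \<le> grad f x \<bullet> z"
    and a: "a \<in> active \<sigma>" "\<And>z. z \<in> active \<sigma> \<Longrightarrow> grad f x \<bullet> z \<le> grad f x \<bullet> a"
    and d: "grad f x \<bullet> (a - v) \<le> 2 * (grad f x \<bullet> (x - v))"
    and bt: "backtrack f \<tau> \<eta> x (v - x) (estimate \<sigma>) 1 \<gamma> L" "0 < \<eta>"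
    and \<sigma>': "\<sigma>' = fw_next X (x + \<gamma> *\<^sub>R (v - x)) (fw_weights \<gamma> v w) L"
  shows "admissible \<sigma>' \<and> (0 \<le> mu \<longrightarrow> progress \<sigma> \<sigma>')"
proof -
  have xL: "x \<in> L0" and bar: "barycentric (vertices X) w x" and act: "active \<sigma> = support_on (vertices X) w"
    and est: "0 < estimate \<sigma>" "estimate \<sigma> \<le> Lt"
    using adm by (auto simp: admissible_def x w)
  have xX: "x \<in> X" and vX: "v \<in> X" using barycentric_in_X[OF bar] v(1) vertices_subset by blast+
  have desc: "grad f x \<bullet> (v - x) \<le> 0" using v(2)[OF xX] by (simp add: inner_diff_right)
  have seg: "x + s *\<^sub>R (v - x) \<in> X" if "0 \<le> s" "s \<le> 1" for s
    by (rule barycentric_in_X[OF barycentric_fw[OF bar v(1) that]])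
  note bp = backtrack_progress[OF bt est xL desc zero_le_one seg norm_diff_le_diameter[OF vX xX]]
  have adm': "admissible \<sigma>'"
    using bp barycentric_fw[OF bar v(1) bp(3,4)]
    by (simp add: admissible_def \<sigma>' fw_next_def support_on_def)
  have card: "card (active \<sigma>') \<le> card (active \<sigma>) + 1"
    using card_support_fw[OF finite_vert bp(3,4), of w v] bar
    by (simp add: \<sigma>' fw_next_def act barycentric_def support_on_def)
  have "gap (x + \<gamma> *\<^sub>R (v - x)) \<le> rate * gap x" if mu: "0 \<le> mu"
    using bp(7)
  proof
    \<comment> \<open>A full step gains half of the Frank-Wolfe gap, which by the tangent inequality
      is at least the primal gap; the factor 1/2 is below \<open>rate\<close>.\<close>
    assume "\<gamma> = 1 \<and> gap (x + \<gamma> *\<^sub>R (v - x)) \<le> gap x - 1 * - (grad f x \<bullet> (v - x)) / 2"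
    hence "gap (x + \<gamma> *\<^sub>R (v - x)) \<le> gap x - 1 * - (grad f x \<bullet> (v - x)) / 2" by blast
    hence "gap (x + \<gamma> *\<^sub>R (v - x)) \<le> gap x + (grad f x \<bullet> (v - x)) / 2" by simp
    also have "grad f x \<bullet> (v - x) \<le> - gap x"
      using v(2)[of xstar] xstar_L0 above_tangent[of x xstar] xL L0_edom
      by (auto simp: gap_def L0_iff inner_diff_right)
    also have "gap x + - gap x / 2 \<le> rate * gap x"
      using mult_right_mono[OF rate_bounds(1)[OF mu] gap_nonneg[OF xL]] gap_nonneg[OF xL] by linarith
    finally show ?thesis by simp
  next
    assume dec: "(grad f x \<bullet> (v - x))\<^sup>2 \<le> (gap x - gap (x + \<gamma> *\<^sub>R (v - x))) * (2 * Lt * (diameter X)\<^sup>2)"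
    show ?thesis
    proof (rule contraction[OF mu xL support_on_proper_support[OF bar] v(2), folded act, OF _ a(2) _ _ dec])
      show "a \<in> X" using a(1) act vertices_subset by (auto simp: support_on_def)
      show "grad f x \<bullet> (a - v) \<le> 2 * - (grad f x \<bullet> (v - x))"
        using d by (simp add: inner_diff_right)
    qed
  qed
  thus ?thesis using adm' card by (simp add: progress_def \<sigma>' x fw_next_def)
qed

text \<open>Away and pairwise steps: \<open>W s\<close> are the weights after a step of length \<open>s\<close>.\<close>
lemma drop_step_progress:
  assumes adm: "admissible \<sigma>" and x: "x = iterate \<sigma>"
    and v: "v \<in> vertices X" "\<And>z. z \<in> X \<Longrightarrow> grad f x \<bullet> v \<le> grad f x \<bullet> z"
    and a: "a \<in> active \<sigma>" "\<And>z. z \<in> active \<sigma> \<Longrightarrow> grad f x \<bullet> z \<le> grad f x \<bullet> a"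
    and d: "grad f x \<bullet> (a - v) \<le> 2 * - (grad f x \<bullet> d)" "norm d \<le> diameter X"
    and bt: "backtrack f \<tau> \<eta> x d (estimate \<sigma>) \<gamma>max \<gamma> L" "0 < \<eta>" and \<gamma>max: "0 \<le> \<gamma>max"
    and bar: "\<And>s. 0 \<le> s \<Longrightarrow> s \<le> \<gamma>max \<Longrightarrow> barycentric (vertices X) (W s) (x + s *\<^sub>R d)"
    and sub: "\<And>s. 0 \<le> s \<Longrightarrow> support_on (vertices X) (W s) \<subseteq> active \<sigma>"
    and drop: "W \<gamma>max a = 0"
    and \<sigma>': "\<sigma>' = fw_next X (x + \<gamma> *\<^sub>R d) (W \<gamma>) L"
  shows "admissible \<sigma>' \<and> (0 \<le> mu \<longrightarrow> progress \<sigma> \<sigma>')"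
proof -
  define w where "w = weight \<sigma>"
  have xL: "x \<in> L0" and barw: "barycentric (vertices X) w x" and act: "active \<sigma> = support_on (vertices X) w"
    and est: "0 < estimate \<sigma>" "estimate \<sigma> \<le> Lt"
    using adm by (auto simp: admissible_def x w_def)
  have aX: "a \<in> X" using a(1) act vertices_subset by (auto simp: support_on_def)
  \<comment> \<open>Minimality of \<open>v\<close> makes the left side of \<open>d(1)\<close>
    nonnegative.\<close>
  have desc: "grad f x \<bullet> d \<le> 0" using v(2)[OF aX] d(1) by (simp add: inner_diff_right)
  note bp = backtrack_progress[OF bt est xL desc \<gamma>max barycentric_in_X[OF bar] d(2)]
  have act': "active \<sigma>' = support_on (vertices X) (W \<gamma>)" by (simp add: \<sigma>' fw_next_def support_on_def)
  have adm': "admissible \<sigma>'"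
    using bp bar[OF bp(3,4)] act' by (simp add: admissible_def \<sigma>' fw_next_def)
  have "progress \<sigma> \<sigma>'" if mu: "0 \<le> mu"
    using bp(7)
  proof
    assume "\<gamma> = \<gamma>max \<and> gap (x + \<gamma> *\<^sub>R d) \<le> gap x - \<gamma>max * - (grad f x \<bullet> d) / 2"
    hence "W \<gamma> a = 0" using drop by simp
    hence "card (active \<sigma>') < card (active \<sigma>)"
      using card_support_drop[OF finite_vert sub[OF bp(3), unfolded act]] a(1) unfolding act act' by blast
    thus ?thesis using bp(6) by (simp add: progress_def \<sigma>' x fw_next_def)
  next
    assume dec: "(grad f x \<bullet> d)\<^sup>2 \<le> (gap x - gap (x + \<gamma> *\<^sub>R d)) * (2 * Lt * (diameter X)\<^sup>2)"
    have "gap (x + \<gamma> *\<^sub>R d) \<le> rate * gap x"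
      by (rule contraction[OF mu xL support_on_proper_support[OF barw] v(2), folded act, OF _ a(2) aX d(1) dec])
    moreover have "card (active \<sigma>') \<le> card (active \<sigma>)"
      unfolding act' by (rule card_mono[OF _ sub[OF bp(3)]]) (simp add: act support_on_def finite_vert)
    ultimately show ?thesis by (simp add: progress_def \<sigma>' x fw_next_def)
  qed
  thus ?thesis using adm' by blast
qed

lemma bafw_step_progress:
  assumes adm: "admissible \<sigma>" and step: "bafw_step f X \<tau> \<eta> \<sigma> \<sigma>'" and \<eta>: "0 < \<eta>"
  shows "admissible \<sigma>' \<and> (0 \<le> mu \<longrightarrow> progress \<sigma> \<sigma>')"
proof -
  define x where "x = iterate \<sigma>"
  define w where "w = weight \<sigma>"
  define g where "g = grad f x"
  obtain v a \<gamma> L where v: "v \<in> vertices X" "is_arg_min (\<lambda>y. g \<bullet> y) (\<lambda>y. y \<in> X) v"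
    and a: "is_arg_max (\<lambda>y. g \<bullet> y) (\<lambda>y. y \<in> active \<sigma>) a"
    and st: "if g \<bullet> (x - v) \<ge> g \<bullet> (a - x) then
           backtrack f \<tau> \<eta> x (v - x) (estimate \<sigma>) 1 \<gamma> L \<and>
           \<sigma>' = fw_next X (x + \<gamma> *\<^sub>R (v - x)) (fw_weights \<gamma> v w) L
         else
           backtrack f \<tau> \<eta> x (x - a) (estimate \<sigma>) (w a / (1 - w a)) \<gamma> L \<and>
           \<sigma>' = fw_next X (x + \<gamma> *\<^sub>R (x - a)) (away_weights \<gamma> a w) L"
    using step unfolding bafw_step_def Let_def x_def w_def g_def by blast
  have v': "g \<bullet> v \<le> g \<bullet> z" if "z \<in> X" for z
    using v(2) that by (auto simp: is_arg_min_def not_less)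
  have a': "a \<in> active \<sigma>" and a'': "\<And>z. z \<in> active \<sigma> \<Longrightarrow> g \<bullet> z \<le> g \<bullet> a"
    using a by (auto simp: is_arg_max_def not_less)
  have bar: "barycentric (vertices X) w x" and act: "active \<sigma> = support_on (vertices X) w"
    using adm by (auto simp: admissible_def x_def w_def)
  have xX: "x \<in> X" using barycentric_in_X[OF bar] .
  have aV: "a \<in> vertices X" and wa: "0 < w a" using a' act by (auto simp: support_on_def)
  show ?thesis
  proof (cases "g \<bullet> (x - v) \<ge> g \<bullet> (a - x)")
    case True
    have "g \<bullet> (a - v) \<le> 2 * (g \<bullet> (x - v))" using True by (simp add: inner_diff_right)
    moreover have "backtrack f \<tau> \<eta> x (v - x) (estimate \<sigma>) 1 \<gamma> L"
      "\<sigma>' = fw_next X (x + \<gamma> *\<^sub>R (v - x)) (fw_weights \<gamma> v w) L" using st True by auto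
    ultimately show ?thesis
      using fw_step_progress[OF adm x_def w_def v(1), folded g_def, OF v' a' a''] \<eta> by blast
  next
    case False
    hence bt: "backtrack f \<tau> \<eta> x (x - a) (estimate \<sigma>) (w a / (1 - w a)) \<gamma> L"
      and \<sigma>': "\<sigma>' = fw_next X (x + \<gamma> *\<^sub>R (x - a)) (away_weights \<gamma> a w) L" using st by auto
    \<comment> \<open>Otherwise \<open>x = a\<close>, and the failed test would read
      \<open>g \<bullet> (x - v) < 0\<close>, against minimality of \<open>v\<close>.\<close>
    have "w a \<noteq> 1"
      using barycentric_weight_eq_1[OF bar aV] False v'[OF xX] by (auto simp: inner_diff_right)
    hence wa1: "0 < 1 - w a" using barycentric_weight_le_1[OF bar aV] by simp
    show ?thesis
    proof (rule drop_step_progress[OF adm x_def v(1), folded g_def,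
          where W = "\<lambda>r. away_weights r a w", OF v' a' a'' _ _ bt \<eta> _ _ _ _ \<sigma>'])
      show "g \<bullet> (a - v) \<le> 2 * - (g \<bullet> (x - a))" using False by (simp add: inner_diff_right)
      show "norm (x - a) \<le> diameter X" using norm_diff_le_diameter xX aV vertices_subset by blast
      show "0 \<le> w a / (1 - w a)" using wa wa1 by simp
      show "barycentric (vertices X) (away_weights s a w) (x + s *\<^sub>R (x - a))"
        if "0 \<le> s" "s \<le> w a / (1 - w a)" for s
        by (rule barycentric_away[OF bar aV that(1)]) (use that(2) wa1 in \<open>simp add: pos_le_divide_eq\<close>)
      show "support_on (vertices X) (away_weights s a w) \<subseteq> active \<sigma>" if "0 \<le> s" for s
        unfolding act by (rule support_away_subset[OF that])
      show "away_weights (w a / (1 - w a)) a w a = 0" using wa1 by (simp add: away_weights_def field_simps)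
    qed
  qed
qed

lemma bbpcg_step_progress:
  assumes adm: "admissible \<sigma>" and step: "bbpcg_step f X \<tau> \<eta> \<sigma> \<sigma>'" and \<eta>: "0 < \<eta>"
  shows "admissible \<sigma>' \<and> (0 \<le> mu \<longrightarrow> progress \<sigma> \<sigma>')"
proof -
  define x where "x = iterate \<sigma>"
  define w where "w = weight \<sigma>"
  define g where "g = grad f x"
  obtain v a s \<gamma> L where v: "v \<in> vertices X" "is_arg_min (\<lambda>y. g \<bullet> y) (\<lambda>y. y \<in> X) v"
    and a: "is_arg_max (\<lambda>y. g \<bullet> y) (\<lambda>y. y \<in> active \<sigma>) a"
    and s: "is_arg_min (\<lambda>y. g \<bullet> y) (\<lambda>y. y \<in> active \<sigma>) s"
    and st: "if g \<bullet> (x - v) \<ge> g \<bullet> (a - s) then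
           backtrack f \<tau> \<eta> x (v - x) (estimate \<sigma>) 1 \<gamma> L \<and>
           \<sigma>' = fw_next X (x + \<gamma> *\<^sub>R (v - x)) (fw_weights \<gamma> v w) L
         else
           backtrack f \<tau> \<eta> x (s - a) (estimate \<sigma>) (w a) \<gamma> L \<and>
           \<sigma>' = fw_next X (x + \<gamma> *\<^sub>R (s - a)) (pairwise_weights \<gamma> a s w) L"
    using step unfolding bbpcg_step_def Let_def x_def w_def g_def by blast
  have v': "g \<bullet> v \<le> g \<bullet> z" if "z \<in> X" for z
    using v(2) that by (auto simp: is_arg_min_def not_less)
  have a': "a \<in> active \<sigma>" and a'': "\<And>z. z \<in> active \<sigma> \<Longrightarrow> g \<bullet> z \<le> g \<bullet> a"
    using a by (auto simp: is_arg_max_def not_less)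
  have s': "s \<in> active \<sigma>" and s'': "\<And>z. z \<in> active \<sigma> \<Longrightarrow> g \<bullet> s \<le> g \<bullet> z"
    using s by (auto simp: is_arg_min_def not_less)
  have bar: "barycentric (vertices X) w x" and act: "active \<sigma> = support_on (vertices X) w"
    using adm by (auto simp: admissible_def x_def w_def)
  have xX: "x \<in> X" using barycentric_in_X[OF bar] .
  have aV: "a \<in> vertices X" and wa: "0 < w a" and sV: "s \<in> vertices X"
    using a' s' act by (auto simp: support_on_def)
  \<comment> \<open>\<open>x\<close> is a convex combination of active vertices, so it lies in the
    half-space above their minimum. Both branches need this to pass from
    \<open>g \<bullet> (s - v)\<close> to \<open>g \<bullet> (x - v)\<close>.\<close>
  have sx: "g \<bullet> s \<le> g \<bullet> x"
  proof -
    have "x \<in> {z. g \<bullet> s \<le> g \<bullet> z}"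
    proof (rule barycentric_mem)
      show "barycentric (active \<sigma>) w x"
        unfolding act by (rule barycentric_support_on[OF bar])
      show "convex {z. g \<bullet> s \<le> g \<bullet> z}" by (rule convex_halfspace_ge)
    qed (use s'' in auto)
    thus ?thesis by simp
  qed
  show ?thesis
  proof (cases "g \<bullet> (x - v) \<ge> g \<bullet> (a - s)")
    case True
    have "g \<bullet> (a - v) \<le> 2 * (g \<bullet> (x - v))" using True sx by (simp add: inner_diff_right)
    moreover have "backtrack f \<tau> \<eta> x (v - x) (estimate \<sigma>) 1 \<gamma> L"
      "\<sigma>' = fw_next X (x + \<gamma> *\<^sub>R (v - x)) (fw_weights \<gamma> v w) L" using st True by auto
    ultimately show ?thesis
      using fw_step_progress[OF adm x_def w_def v(1), folded g_def, OF v' a' a''] \<eta> by blast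
  next
    case False
    hence bt: "backtrack f \<tau> \<eta> x (s - a) (estimate \<sigma>) (w a) \<gamma> L"
      and \<sigma>': "\<sigma>' = fw_next X (x + \<gamma> *\<^sub>R (s - a)) (pairwise_weights \<gamma> a s w) L" using st by auto
    \<comment> \<open>With \<open>s = a\<close> the test would have succeeded. Distinctness matters
      for the drop: otherwise the weight removed from \<open>a\<close> would return to it.\<close>
    have sa: "s \<noteq> a" using False v'[OF xX] by (auto simp: inner_diff_right)
    show ?thesis
    proof (rule drop_step_progress[OF adm x_def v(1), folded g_def,
          where W = "\<lambda>r. pairwise_weights r a s w", OF v' a' a'' _ _ bt \<eta> _ _ _ _ \<sigma>'])
      show "g \<bullet> (a - v) \<le> 2 * - (g \<bullet> (s - a))" using False sx by (simp add: inner_diff_right)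
      show "norm (s - a) \<le> diameter X" using norm_diff_le_diameter sV aV vertices_subset by blast
      show "0 \<le> w a" using wa by simp
      show "barycentric (vertices X) (pairwise_weights r a s w) (x + r *\<^sub>R (s - a))"
        if "0 \<le> r" "r \<le> w a" for r
        by (rule barycentric_pairwise[OF bar aV sV that])
      show "support_on (vertices X) (pairwise_weights r a s w) \<subseteq> active \<sigma>" if "0 \<le> r" for r
        unfolding act by (rule support_pairwise_subset[OF that s'[unfolded act]])
      show "pairwise_weights (w a) a s w a = 0" using sa by (simp add: pairwise_weights_def)
    qed
  qed
qed

section \<open>Counting contractions along a run\<close>

lemma admissible_init: "admissible (fw_init x0 Linit)"
proof -
  have "barycentric (vertices X) (\<lambda>u. if u = x0 then 1 else 0) x0"
    using sum_single_weight[OF finite_vert x0_vertex, of 1] finite_vert by (simp add: barycentric_def)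
  thus ?thesis
    using x0_L0 x0_vertex Linit by (auto simp: admissible_def fw_init_def support_on_def Lt_def)
qed

text \<open>Every contraction raises \<open>|active| + t\<close> by at most two and a drop step does not raise it, so at
  least half of the steps are contractions.\<close>
lemma linear_rate:
  assumes step: "\<And>\<sigma> \<sigma>'. admissible \<sigma> \<Longrightarrow> step \<sigma> \<sigma>' \<Longrightarrow> admissible \<sigma>' \<and> (0 \<le> mu \<longrightarrow> progress \<sigma> \<sigma>')"
    and reach: "(step ^^ t) (fw_init x0 Linit) \<sigma>"
  shows "f (iterate \<sigma>) - f xstar \<le> (f x0 - f xstar) * ereal (rate ^ nat \<lceil>(real t - 1) / 2\<rceil>)"
proof -
  \<comment> \<open>Here \<open>c\<close> counts contractions, and the summand 1 is the size of the
    initial active set.\<close>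
  have inv: "admissible \<sigma> \<and> (0 \<le> mu \<longrightarrow>
      (\<exists>c. gap (iterate \<sigma>) \<le> rate ^ c * gap x0 \<and> card (active \<sigma>) + t \<le> 2 * c + 1))"
    using reach
  proof (induction t arbitrary: \<sigma>)
    case 0
    thus ?case using admissible_init by (auto simp: fw_init_def intro!: exI[of _ 0])
  next
    case (Suc t)
    then obtain \<rho> where \<rho>: "(step ^^ t) (fw_init x0 Linit) \<rho>" "step \<rho> \<sigma>" by auto
    note IH = Suc.IH[OF \<rho>(1)]
    have st: "admissible \<sigma> \<and> (0 \<le> mu \<longrightarrow> progress \<rho> \<sigma>)" using step \<rho>(2) IH by blast
    have "\<exists>c. gap (iterate \<sigma>) \<le> rate ^ c * gap x0 \<and> card (active \<sigma>) + Suc t \<le> 2 * c + 1"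
      if mu: "0 \<le> mu"
    proof -
      obtain c where c: "gap (iterate \<rho>) \<le> rate ^ c * gap x0" "card (active \<rho>) + t \<le> 2 * c + 1"
        using IH mu by blast
      have "progress \<rho> \<sigma>" using st mu by blast
      thus ?thesis unfolding progress_def
      proof (elim disjE conjE)
        assume 1: "gap (iterate \<sigma>) \<le> rate * gap (iterate \<rho>)" "card (active \<sigma>) \<le> card (active \<rho>) + 1"
        have "rate * gap (iterate \<rho>) \<le> rate * (rate ^ c * gap x0)"
          using c(1) rate_bounds(1)[OF mu] by (intro mult_left_mono) auto
        hence "gap (iterate \<sigma>) \<le> rate ^ Suc c * gap x0" using 1 by (simp add: mult.assoc)
        thus ?thesis using 1(2) c(2) by (intro exI[of _ "Suc c"]) simp
      next
        assume "gap (iterate \<sigma>) \<le> gap (iterate \<rho>)" "card (active \<sigma>) < card (active \<rho>)"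
        thus ?thesis using c by (intro exI[of _ c]) auto
      qed
    qed
    thus ?case using st by blast
  qed
  let ?n = "nat \<lceil>(real t - 1) / 2\<rceil>"
  have L: "iterate \<sigma> \<in> L0" using inv by (simp add: admissible_def)
  have g0: "0 \<le> gap x0" using gap_nonneg[OF x0_L0] .
  have "gap (iterate \<sigma>) \<le> gap x0 * rate ^ ?n"
  proof (cases "0 \<le> mu")
    case True
    then obtain c where c: "gap (iterate \<sigma>) \<le> rate ^ c * gap x0" "t \<le> 2 * c + 1"
      using inv by (meson le_add2 order_trans)
    \<comment> \<open>From \<open>t \<le> 2 * c + 1\<close> one gets
      \<open>(t - 1) / 2 \<le> c\<close>, and \<open>c\<close> is an integer.\<close>
    have "?n \<le> c" using c(2) by (simp add: nat_le_iff ceiling_le_iff)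
    hence "rate ^ c \<le> rate ^ ?n" using rate_bounds[OF True] by (intro power_decreasing) auto
    from mult_right_mono[OF this g0] show ?thesis using c(1) by (simp add: mult.commute)
  next
    case False
    \<comment> \<open>For negative \<open>mu\<close> the factor is at least one, so it suffices that
      \<open>L0\<close> contains no value above \<open>f x0\<close>.\<close>
    hence "mu / (4 * Lt) * (pyramidal_width X / diameter X)\<^sup>2 \<le> 0"
      using Lt_pos by (intro mult_nonpos_nonneg) (auto simp: divide_le_0_iff)
    hence "1 \<le> rate ^ ?n" by (intro one_le_power) (simp add: rate_def)
    from mult_left_mono[OF this g0] show ?thesis using gap_le_gap_x0[OF L] by simp
  qed
  moreover have "iterate \<sigma> \<in> edom f" "xstar \<in> edom f" using L xstar_L0 L0_edom by auto
  ultimately show ?thesis using x0_edom by (simp add: ereal_rpart gap_def)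
qed

end

theorem theorem3p2:
  fixes X :: "(real^'n) set" and f :: "real^'n \<Rightarrow> ereal"
    and M \<nu> \<tau> \<eta> Linit :: real and x0 xstar :: "real^'n"
  defines "\<L>0 \<equiv> {x \<in> edom f \<inter> X. f x \<le> f x0}"
    and "h \<equiv> (\<lambda>x. f x - f xstar)"
  defines "Ltilde \<equiv> max (\<tau> * smoothness_const f \<L>0) Linit"
  defines "q \<equiv> 1 - strong_convexity_const f \<L>0 / (4 * Ltilde)
                     * (pyramidal_width X / diameter X)\<^sup>2"
  assumes "polytope X" and "diameter X > 0"
    and "gen_self_concordant M \<nu> f" and "\<nu> \<ge> 2" and "\<not> contains_line (edom f)"
    and "x0 \<in> vertices X" and "x0 \<in> edom f"
    and "is_arg_min f (\<lambda>x. x \<in> X) xstar"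
    and "\<tau> > 1" and "0 < \<eta>" and "\<eta> \<le> 1" and "Linit > 0"
  shows "(\<forall>t\<ge>1. \<forall>\<sigma>. bafw_reach f X \<tau> \<eta> Linit x0 t \<sigma> \<longrightarrow>
            h (iterate \<sigma>) \<le> h x0 * ereal (q ^ nat \<lceil>(real t - 1) / 2\<rceil>)) \<and>
         (\<forall>t\<ge>1. \<forall>\<sigma>. bbpcg_reach f X \<tau> \<eta> Linit x0 t \<sigma> \<longrightarrow>
            h (iterate \<sigma>) \<le> h x0 * ereal (q ^ nat \<lceil>(real t - 1) / 2\<rceil>))"
proof -
  have f: "closed_convex_fun f" "open (edom f)" "Ck_on 3 (rpart f) (edom f)"
    using \<open>gen_self_concordant M \<nu> f\<close> by (simp_all only: gen_self_concordant_def)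
  from f(3) have C2: "Ck_on 2 (rpart f) (edom f)"
    unfolding numeral_3_eq_3 numeral_2_eq_2 by (rule Ck_on_Suc_imp_Ck_on)
  interpret fw_problem f X \<tau> Linit x0 xstar
    by unfold_locales (fact f C2 assms)+
  have q: "q = rate"
    by (simp add: q_def Ltilde_def \<L>0_def rate_def mu_def Lt_def Lf_def L0_def)
  show ?thesis
    unfolding bafw_reach_def bbpcg_reach_def h_def q
  proof (intro conjI allI impI)
    fix t \<sigma> assume "(bafw_step f X \<tau> \<eta> ^^ t) (fw_init x0 Linit) \<sigma>"
    from linear_rate[OF bafw_step_progress[OF _ _ \<open>0 < \<eta>\<close>] this]
    show "f (iterate \<sigma>) - f xstar \<le> (f x0 - f xstar) * ereal (rate ^ nat \<lceil>(real t - 1) / 2\<rceil>)" .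
  next
    fix t \<sigma> assume "(bbpcg_step f X \<tau> \<eta> ^^ t) (fw_init x0 Linit) \<sigma>"
    from linear_rate[OF bbpcg_step_progress[OF _ _ \<open>0 < \<eta>\<close>] this]
    show "f (iterate \<sigma>) - f xstar \<le> (f x0 - f xstar) * ereal (rate ^ nat \<lceil>(real t - 1) / 2\<rceil>)" .
  qed
qed

end
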